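(* Let $X^7$ be a $3$-Sasakian $7$-manifold, with its two Einstein metrics $g^{ts}=\eta_i\otimes\eta_i+\pi^*g_Z$ and $g^{np}=\frac15\eta_i\otimes\eta_i+\pi^*g_Z$; the $\mathrm{G}_2$-structures $\varphi_{1,\varepsilon}$ induce $g^{ts}$ and $\varphi_{1/\sqrt5,\varepsilon}$ induce $g^{np}$ for $\varepsilon\in\{\pm1\}$. Consider connections of the form $A=i(a_1\eta_1+a_2\eta_2+a_3\eta_3)$, $a_1,a_2,a_3\in\mathbb{R}$, on the trivial complex line bundle over $X$. Then: (1) among such connections there is a circle of non-trivial deformed $\mathrm{G}_2$-instantons with respect to $\varphi_{1,-1}$, whereas there are no non-trivial deformed $\mathrm{G}_2$-instantons with respect to $\varphi_{1,+1}$; (2) among such connections there is a circle plus two isolated examples of non-trivial deformed $\mathrm{G}_2$-instantons with respect to $\varphi_{1/\sqrt5,-1}$, whereas there is a $2$-sphere of non-trivial deformed $\mathrm{G}_2$-instantons with respect to $\varphi_{1/\sqrt5,+1}$.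
   Context: Setting. A complete Riemannian $7$-manifold $(X^7,g^{ts})$ is $3$-Sasakian if it has three orthonormal Killing fields $\xi_1,\xi_2,\xi_3$ with $[\xi_i,\xi_j]=2\epsilon_{ijk}\xi_k$, each inducing a Sasakian structure; $X$ is then compact. The $\xi_i$ generate a locally free $\mathrm{SU}(2)$-action with leaf space a $4$-orbifold $Z$ and projection $\pi:X\to Z$; $Z$ has a metric $g_Z$, anti-self-dual and Einstein with scalar curvature normalized to $48$, for which $\pi$ is an orbifold Riemannian submersion. The Levi-Civita connection of $Z$ induces a connection $\eta=\eta_i\otimes T_i$ on $\pi$ (with $T_i$ a basis of $\mathfrak{su}(2)$, $[T_i,T_j]=2\epsilon_{ijk}T_k$, and $\eta_i$ $1$-forms on $X$), with horizontal space $H=\ker\eta$ and curvature $d\eta+\frac12[\eta\wedge\eta]=-2\omega_i\otimes T_i$, where $\omega_1,\omega_2,\omega_3$ is an orthogonal basis of $\Lambda^2_+H$ with $|\omega_i|=\sqrt2$. Thus $d\eta_i=-2\omega_i-2\eta_j\wedge\eta_k$ for $(i,j,k)$ cyclic and $\omega_i\wedge\omega_j=2\delta_{ij}\pi^*\mathrm{vol}_Z$. Repeated indices are summed; $\eta_{ij}=\eta_i\wedge\eta_j$. For $t>0$, $\varepsilon\in\{\pm1\}$: $\varphi_{t,\varepsilon}=\varepsilon t^3\eta_1\wedge\eta_2\wedge\eta_3-t(\eta_1\wedge\omega_1+\eta_2\wedge\omega_2+\varepsilon\eta_3\wedge\omega_3)$ is a $\mathrm{G}_2$-structure inducing the metric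 $t^2\eta_i\otimes\eta_i+\pi^*g_Z$, with closed dual $4$-form $\psi_{t,\varepsilon}=\pi^*\mathrm{vol}_Z-t^2(\varepsilon\eta_{23}\wedge\omega_1+\varepsilon\eta_{31}\wedge\omega_2+\eta_{12}\wedge\omega_3)$. A unitary connection $A$ is a deformed $\mathrm{G}_2$-instanton with respect to $\varphi$ (with dual $4$-form $\psi$) if $\frac16F_A^3+F_A\wedge\psi=0$. On the trivial bundle, connections are written as $i\mathbb{R}$-valued $1$-forms, so $F_A=dA$. Within the stated family of connections, "non-trivial" means $(a_1,a_2,a_3)\ne(0,0,0)$, i.e. not the trivial flat connection, and circles, $2$-spheres and isolated points refer to subsets of the parameter space $\{(a_1,a_2,a_3)\}=\mathbb{R}^3$. *)

theory Defs
  imports "HOL-Analysis.Analysis"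
begin

section \<open>Exterior calculus on an open subset of a vector space\<close>

text \<open>An alternating form is a function on lists of vectors; a form of degree \<open>k\<close> vanishes on
  all lists whose length is not \<open>k\<close>, so degrees need not be carried around.\<close>

type_synonym ('v, 'b) form = "'v list \<Rightarrow> 'b"

definition one_form :: "('v \<Rightarrow> 'b::zero) \<Rightarrow> ('v, 'b) form" where
  "one_form f vs = (case vs of [v] \<Rightarrow> f v | _ \<Rightarrow> 0)"

text \<open>The wedge product by the shuffle formula, normalised so that
  \<open>(\<alpha> \<and> \<beta>)(u, v) = \<alpha>(u) \<beta>(v) - \<alpha>(v) \<beta>(u)\<close> for one-forms. The set \<open>I\<close> contains the positions of
  the vectors that go to \<open>\<alpha>\<close>; the sign is that of the corresponding shuffle.\<close>

definition shuffle_sign :: "nat \<Rightarrow> nat set \<Rightarrow> 'b::comm_ring_1" where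
  "shuffle_sign n I = (-1) ^ card {(i, j). i \<in> I \<and> j \<in> {..<n} - I \<and> j < i}"

definition wedge :: "('v, 'b::comm_ring_1) form \<Rightarrow> ('v, 'b) form \<Rightarrow> ('v, 'b) form"
    (infixr "\<and>\<^sub>\<Lambda>" 70) where
  "(\<alpha> \<and>\<^sub>\<Lambda> \<beta>) vs =
     (\<Sum>I\<in>Pow {..<length vs}.
        shuffle_sign (length vs) I * \<alpha> (nths vs I) * \<beta> (nths vs ({..<length vs} - I)))"

primrec wedge_list :: "('v, 'b::comm_ring_1) form list \<Rightarrow> ('v, 'b) form" where
  "wedge_list [] = (\<lambda>vs. if vs = [] then 1 else 0)"
| "wedge_list (\<alpha> # \<alpha>s) = \<alpha> \<and>\<^sub>\<Lambda> wedge_list \<alpha>s"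

abbreviation directional :: "('v::real_normed_vector \<Rightarrow> 'w::real_normed_vector) \<Rightarrow> 'v \<Rightarrow> 'v \<Rightarrow> 'w"
  where "directional f x u \<equiv> frechet_derivative f (at x) u"

definition ext_d ::
    "('v::real_normed_vector \<Rightarrow> ('v, 'b::real_normed_field) form) \<Rightarrow> 'v \<Rightarrow> ('v, 'b) form" where
  "ext_d \<alpha> x vs =
     (\<Sum>i<length vs. (-1) ^ i * directional (\<lambda>y. \<alpha> y (take i vs @ drop (Suc i) vs)) x (vs ! i))"

primrec Ck_on ::
    "nat \<Rightarrow> 'v::real_normed_vector set \<Rightarrow> ('v \<Rightarrow> 'w::real_normed_vector) \<Rightarrow> bool" where
  "Ck_on 0 S f \<longleftrightarrow> continuous_on S f"
| "Ck_on (Suc k) S f \<longleftrightarrow>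
     (\<forall>x\<in>S. f differentiable (at x)) \<and> (\<forall>v. Ck_on k S (\<lambda>x. directional f x v))"

definition smooth_on :: "'v::real_normed_vector set \<Rightarrow> ('v \<Rightarrow> 'w::real_normed_vector) \<Rightarrow> bool" where
  "smooth_on S f \<longleftrightarrow> (\<forall>k. Ck_on k S f)"


section \<open>Smooth 7-manifolds and tensor fields in charts\<close>

text \<open>A chart is a pair of its domain and its coordinate map. A tensor field is the family of its
  coordinate representations: it takes a chart and a point of the coordinate domain of that chart.
  All the local formulas below are invariant under changes of charts.\<close>

type_synonym vec7 = "real ^ 7"
type_synonym 'p chart = "'p set \<times> ('p \<Rightarrow> vec7)"
type_synonym 'p vfield = "'p chart \<Rightarrow> vec7 \<Rightarrow> vec7"
type_synonym 'p bifield = "'p chart \<Rightarrow> vec7 \<Rightarrow> vec7 \<Rightarrow> vec7 \<Rightarrow> real"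
type_synonym ('p, 'b) formfield = "'p chart \<Rightarrow> vec7 \<Rightarrow> (vec7, 'b) form"

definition chart_image :: "'p chart \<Rightarrow> vec7 set" where
  "chart_image c = snd c ` fst c"

definition overlap :: "'p chart \<Rightarrow> 'p chart \<Rightarrow> vec7 set" where
  "overlap c c' = snd c ` (fst c \<inter> fst c')"

definition transition :: "'p chart \<Rightarrow> 'p chart \<Rightarrow> vec7 \<Rightarrow> vec7" where
  "transition c c' = snd c' \<circ> inv_into (fst c) (snd c)"

definition smooth_atlas :: "'p topology \<Rightarrow> 'p chart set \<Rightarrow> bool" where
  "smooth_atlas X \<A> \<longleftrightarrow>
     Hausdorff_space X \<and> second_countable X \<and> topspace X \<noteq> {} \<and>
     (\<Union>c\<in>\<A>. fst c) = topspace X \<and>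
     (\<forall>c\<in>\<A>. openin X (fst c) \<and> open (chart_image c) \<and>
        homeomorphic_map (subtopology X (fst c)) (top_of_set (chart_image c)) (snd c)) \<and>
     (\<forall>c\<in>\<A>. \<forall>c'\<in>\<A>. smooth_on (overlap c c') (transition c c'))"

definition vector_field :: "'p chart set \<Rightarrow> 'p vfield \<Rightarrow> bool" where
  "vector_field \<A> V \<longleftrightarrow>
     (\<forall>c\<in>\<A>. smooth_on (chart_image c) (V c)) \<and>
     (\<forall>c\<in>\<A>. \<forall>c'\<in>\<A>. \<forall>x\<in>overlap c c'.
        V c' (transition c c' x) = directional (transition c c') x (V c x))"

definition riemannian_metric :: "'p chart set \<Rightarrow> 'p bifield \<Rightarrow> bool" where
  "riemannian_metric \<A> g \<longleftrightarrow>
     (\<forall>c\<in>\<A>. (\<forall>u v. smooth_on (chart_image c) (\<lambda>x. g c x u v)) \<and>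
        (\<forall>x\<in>chart_image c. bilinear (g c x) \<and> (\<forall>u v. g c x u v = g c x v u) \<and>
           (\<forall>u. u \<noteq> 0 \<longrightarrow> g c x u u > 0))) \<and>
     (\<forall>c\<in>\<A>. \<forall>c'\<in>\<A>. \<forall>x\<in>overlap c c'. \<forall>u v.
        g c x u v = g c' (transition c c' x)
          (directional (transition c c') x u) (directional (transition c c') x v))"


section \<open>Riemannian geometry in a chart\<close>

text \<open>In what follows \<open>G\<close> is the coordinate representation of the metric in one chart.
  The Christoffel symbols are determined by the Koszul formula for constant vector fields.\<close>

definition christoffel :: "(vec7 \<Rightarrow> vec7 \<Rightarrow> vec7 \<Rightarrow> real) \<Rightarrow> vec7 \<Rightarrow> vec7 \<Rightarrow> vec7 \<Rightarrow> vec7" where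
  "christoffel G x u v =
     (THE w. \<forall>z. 2 * G x w z =
        directional (\<lambda>y. G y v z) x u + directional (\<lambda>y. G y u z) x v
          - directional (\<lambda>y. G y u v) x z)"

definition nabla ::
    "(vec7 \<Rightarrow> vec7 \<Rightarrow> vec7 \<Rightarrow> real) \<Rightarrow> (vec7 \<Rightarrow> vec7) \<Rightarrow> vec7 \<Rightarrow> vec7 \<Rightarrow> vec7" where
  "nabla G V x u = directional V x u + christoffel G x u (V x)"

definition nabla_endo ::
    "(vec7 \<Rightarrow> vec7 \<Rightarrow> vec7 \<Rightarrow> real) \<Rightarrow> (vec7 \<Rightarrow> vec7 \<Rightarrow> vec7) \<Rightarrow> vec7 \<Rightarrow> vec7 \<Rightarrow> vec7 \<Rightarrow> vec7" where
  "nabla_endo G \<Phi> x u v =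
     directional (\<lambda>y. \<Phi> y v) x u + christoffel G x u (\<Phi> x v) - \<Phi> x (christoffel G x u v)"

definition lie_bracket :: "(vec7 \<Rightarrow> vec7) \<Rightarrow> (vec7 \<Rightarrow> vec7) \<Rightarrow> vec7 \<Rightarrow> vec7" where
  "lie_bracket V W x = directional W x (V x) - directional V x (W x)"

definition killing_field :: "'p chart set \<Rightarrow> 'p bifield \<Rightarrow> 'p vfield \<Rightarrow> bool" where
  "killing_field \<A> g V \<longleftrightarrow> vector_field \<A> V \<and>
     (\<forall>c\<in>\<A>. \<forall>x\<in>chart_image c. \<forall>u v.
        directional (\<lambda>y. g c y u v) x (V c x)
          + g c x (directional (V c) x u) v + g c x u (directional (V c) x v) = 0)"

text \<open>A unit Killing field \<open>V\<close> induces a Sasakian structure if \<open>\<Phi> = -\<nabla>V\<close> satisfies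
  \<open>(\<nabla>\<^sub>u \<Phi>) v = g(u, v) V - g(V, v) u\<close>.\<close>

definition sasakian :: "'p chart set \<Rightarrow> 'p bifield \<Rightarrow> 'p vfield \<Rightarrow> bool" where
  "sasakian \<A> g V \<longleftrightarrow> killing_field \<A> g V \<and>
     (\<forall>c\<in>\<A>. \<forall>x\<in>chart_image c. g c x (V c x) (V c x) = 1 \<and>
        (\<forall>u v. nabla_endo (g c) (\<lambda>y w. - nabla (g c) (V c) y w) x u v =
                 g c x u v *\<^sub>R V c x - g c x (V c x) v *\<^sub>R u))"

definition geodesic ::
    "'p topology \<Rightarrow> 'p chart set \<Rightarrow> 'p bifield \<Rightarrow> (real \<Rightarrow> 'p) \<Rightarrow> bool" where
  "geodesic X \<A> g \<gamma> \<longleftrightarrow> continuous_map euclideanreal X \<gamma> \<and>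
     (\<forall>c\<in>\<A>. \<forall>t. \<gamma> t \<in> fst c \<longrightarrow>
        (let y = snd c \<circ> \<gamma>; y' = (\<lambda>s. vector_derivative y (at s)) in
           y differentiable (at t) \<and>
           (y' has_vector_derivative - christoffel (g c) (y t) (y' t) (y' t)) (at t)))"

definition geodesically_complete :: "'p topology \<Rightarrow> 'p chart set \<Rightarrow> 'p bifield \<Rightarrow> bool" where
  "geodesically_complete X \<A> g \<longleftrightarrow>
     (\<forall>c\<in>\<A>. \<forall>p\<in>fst c. \<forall>v. \<exists>\<gamma>. geodesic X \<A> g \<gamma> \<and> \<gamma> 0 = p \<and>
        ((snd c \<circ> \<gamma>) has_vector_derivative v) (at 0))"


section \<open>3-Sasakian 7-manifolds\<close>

text \<open>The three fields are indexed by the type \<open>3\<close>, whose arithmetic is modulo \<open>3\<close>: the cyclic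
  permutations of \<open>(1, 2, 3)\<close> are the triples \<open>(i, i + 1, i + 2)\<close>.\<close>

definition three_sasakian ::
    "'p topology \<Rightarrow> 'p chart set \<Rightarrow> 'p bifield \<Rightarrow> (3 \<Rightarrow> 'p vfield) \<Rightarrow> bool" where
  "three_sasakian X \<A> g \<xi> \<longleftrightarrow>
     smooth_atlas X \<A> \<and> riemannian_metric \<A> g \<and> geodesically_complete X \<A> g \<and>
     (\<forall>i. killing_field \<A> g (\<xi> i)) \<and>
     (\<forall>c\<in>\<A>. \<forall>x\<in>chart_image c. \<forall>i j. g c x (\<xi> i c x) (\<xi> j c x) = (if i = j then 1 else 0)) \<and>
     (\<forall>c\<in>\<A>. \<forall>x\<in>chart_image c. \<forall>i.
        lie_bracket (\<xi> i c) (\<xi> (i + 1) c) x = 2 *\<^sub>R \<xi> (i + 2) c x) \<and>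
     (\<forall>i. sasakian \<A> g (\<xi> i))"

definition eta :: "'p bifield \<Rightarrow> (3 \<Rightarrow> 'p vfield) \<Rightarrow> 3 \<Rightarrow> ('p, real) formfield" where
  "eta g \<xi> i c x = one_form (\<lambda>v. g c x (\<xi> i c x) v)"

text \<open>The \<open>i\<close>-th component of the curvature identity \<open>d\<eta> + 1/2 [\<eta> \<and> \<eta>] = - 2 \<omega>\<^sub>i \<otimes> T\<^sub>i\<close>, with
  \<open>[T\<^sub>i, T\<^sub>j] = 2 \<epsilon>\<^sub>i\<^sub>j\<^sub>k T\<^sub>k\<close>, reads \<open>d\<eta>\<^sub>i + 2 \<eta>\<^sub>j \<and> \<eta>\<^sub>k = - 2 \<omega>\<^sub>i\<close> for \<open>(i, j, k)\<close> cyclic.\<close>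

definition omega :: "'p bifield \<Rightarrow> (3 \<Rightarrow> 'p vfield) \<Rightarrow> 3 \<Rightarrow> ('p, real) formfield" where
  "omega g \<xi> i c x vs =
     - (1/2) * (ext_d (eta g \<xi> i c) x vs
                 + 2 * (eta g \<xi> (i + 1) c x \<and>\<^sub>\<Lambda> eta g \<xi> (i + 2) c x) vs)"

definition horizontal_part :: "'p bifield \<Rightarrow> (3 \<Rightarrow> 'p vfield) \<Rightarrow> 'p chart \<Rightarrow> vec7 \<Rightarrow> vec7 \<Rightarrow> vec7" where
  "horizontal_part g \<xi> c x u = u - (\<Sum>i\<in>UNIV. eta g \<xi> i c x [u] *\<^sub>R \<xi> i c x)"

text \<open>The projection \<open>\<pi>\<close> onto the leaf space is a Riemannian submersion with vertical space
  spanned by the \<open>\<xi>\<^sub>i\<close>, so \<open>\<pi>\<^sup>* g\<^sub>Z\<close> and \<open>\<pi>\<^sup>* vol\<^sub>Z\<close> are the metric and the volume form of the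
  horizontal distribution. The orientation is the one for which the \<open>\<omega>\<^sub>i\<close> are self-dual.\<close>

definition pull_gZ :: "'p bifield \<Rightarrow> (3 \<Rightarrow> 'p vfield) \<Rightarrow> 'p bifield" where
  "pull_gZ g \<xi> c x u v = g c x (horizontal_part g \<xi> c x u) (horizontal_part g \<xi> c x v)"

definition oriented_horizontal_frame ::
    "'p bifield \<Rightarrow> (3 \<Rightarrow> 'p vfield) \<Rightarrow> 'p chart \<Rightarrow> vec7 \<Rightarrow> (nat \<Rightarrow> vec7) \<Rightarrow> bool" where
  "oriented_horizontal_frame g \<xi> c x e \<longleftrightarrow>
     (\<forall>a<4. \<forall>i. eta g \<xi> i c x [e a] = 0) \<and>
     (\<forall>a<4. \<forall>b<4. g c x (e a) (e b) = (if a = b then 1 else 0)) \<and>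
     (\<forall>i. omega g \<xi> i c x [e 0, e 1] = omega g \<xi> i c x [e 2, e 3] \<and>
          omega g \<xi> i c x [e 0, e 2] = omega g \<xi> i c x [e 3, e 1] \<and>
          omega g \<xi> i c x [e 0, e 3] = omega g \<xi> i c x [e 1, e 2])"

definition pull_volZ :: "'p bifield \<Rightarrow> (3 \<Rightarrow> 'p vfield) \<Rightarrow> ('p, real) formfield" where
  "pull_volZ g \<xi> c x =
     (THE \<nu>. \<exists>e. oriented_horizontal_frame g \<xi> c x e \<and>
        \<nu> = wedge_list (map (\<lambda>a. one_form (g c x (e a))) [0, 1, 2, 3]))"

definition canonical_metric :: "real \<Rightarrow> 'p bifield \<Rightarrow> (3 \<Rightarrow> 'p vfield) \<Rightarrow> 'p bifield" where
  "canonical_metric t g \<xi> c x u v =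
     t\<^sup>2 * (\<Sum>i\<in>UNIV. eta g \<xi> i c x [u] * eta g \<xi> i c x [v]) + pull_gZ g \<xi> c x u v"

definition phi :: "real \<Rightarrow> real \<Rightarrow> 'p bifield \<Rightarrow> (3 \<Rightarrow> 'p vfield) \<Rightarrow> ('p, real) formfield" where
  "phi t \<epsilon> g \<xi> c x vs =
     (let \<eta> = (\<lambda>i. eta g \<xi> i c x); \<omega> = (\<lambda>i. omega g \<xi> i c x) in
        \<epsilon> * t ^ 3 * (\<eta> 1 \<and>\<^sub>\<Lambda> \<eta> 2 \<and>\<^sub>\<Lambda> \<eta> 3) vs
        - t * ((\<eta> 1 \<and>\<^sub>\<Lambda> \<omega> 1) vs + (\<eta> 2 \<and>\<^sub>\<Lambda> \<omega> 2) vs + \<epsilon> * (\<eta> 3 \<and>\<^sub>\<Lambda> \<omega> 3) vs))"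

definition psi :: "real \<Rightarrow> real \<Rightarrow> 'p bifield \<Rightarrow> (3 \<Rightarrow> 'p vfield) \<Rightarrow> ('p, real) formfield" where
  "psi t \<epsilon> g \<xi> c x vs =
     (let \<eta> = (\<lambda>i. eta g \<xi> i c x); \<omega> = (\<lambda>i. omega g \<xi> i c x) in
        pull_volZ g \<xi> c x vs
        - t\<^sup>2 * (\<epsilon> * ((\<eta> 2 \<and>\<^sub>\<Lambda> \<eta> 3) \<and>\<^sub>\<Lambda> \<omega> 1) vs + \<epsilon> * ((\<eta> 3 \<and>\<^sub>\<Lambda> \<eta> 1) \<and>\<^sub>\<Lambda> \<omega> 2) vs
                + ((\<eta> 1 \<and>\<^sub>\<Lambda> \<eta> 2) \<and>\<^sub>\<Lambda> \<omega> 3) vs))"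


section \<open>\<open>G\<^sub>2\<close>-structures and deformed \<open>G\<^sub>2\<close>-instantons\<close>

definition dx :: "7 list \<Rightarrow> (vec7, real) form" where
  "dx is = wedge_list (map (\<lambda>i. one_form (\<lambda>v. v $ i)) is)"

definition standard_phi :: "(vec7, real) form" where
  "standard_phi vs =
     dx [1,2,3] vs + dx [1,4,5] vs + dx [1,6,7] vs + dx [2,4,6] vs
     - dx [2,5,7] vs - dx [3,4,7] vs - dx [3,5,6] vs"

definition standard_psi :: "(vec7, real) form" where
  "standard_psi vs =
     dx [4,5,6,7] vs + dx [2,3,6,7] vs + dx [2,3,4,5] vs + dx [1,3,5,7] vs
     - dx [1,3,4,6] vs - dx [1,2,5,6] vs - dx [1,2,4,7] vs"

text \<open>\<open>\<phi>\<close> is a \<open>G\<^sub>2\<close>-structure with induced metric \<open>h\<close> and dual 4-form \<open>\<psi>\<close>: every tangent space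
  has an identification with \<open>\<real>\<^sup>7\<close> that carries the standard triple to \<open>(\<phi>, h, \<psi>)\<close>.\<close>

definition g2_structure ::
    "'p chart set \<Rightarrow> ('p, real) formfield \<Rightarrow> 'p bifield \<Rightarrow> ('p, real) formfield \<Rightarrow> bool" where
  "g2_structure \<A> \<phi> h \<psi> \<longleftrightarrow>
     (\<forall>c\<in>\<A>. \<forall>x\<in>chart_image c. \<exists>L. linear L \<and> bij L \<and>
        (\<forall>vs. \<phi> c x vs = standard_phi (map L vs)) \<and>
        (\<forall>u v. h c x u v = L u \<bullet> L v) \<and>
        (\<forall>vs. \<psi> c x vs = standard_psi (map L vs)))"

text \<open>A unitary connection on the trivial line bundle is an imaginary-valued one-form \<open>A\<close>, and
  \<open>F\<^sub>A = dA\<close>.\<close>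

definition deformed_g2_instanton ::
    "'p chart set \<Rightarrow> ('p, real) formfield \<Rightarrow> ('p, real) formfield \<Rightarrow> ('p, complex) formfield \<Rightarrow> bool"
  where
  "deformed_g2_instanton \<A> \<phi> \<psi> A \<longleftrightarrow>
     (\<exists>h. g2_structure \<A> \<phi> h \<psi>) \<and>
     (\<forall>c\<in>\<A>. \<forall>x\<in>chart_image c. (\<forall>vs. Re (A c x vs) = 0) \<and>
        (let F = ext_d (A c) x in
           \<forall>vs. (1/6) * (F \<and>\<^sub>\<Lambda> F \<and>\<^sub>\<Lambda> F) vs
                  + (F \<and>\<^sub>\<Lambda> (\<lambda>ws. complex_of_real (\<psi> c x ws))) vs = 0))"

definition eta_connection ::
    "'p bifield \<Rightarrow> (3 \<Rightarrow> 'p vfield) \<Rightarrow> real ^ 3 \<Rightarrow> ('p, complex) formfield" where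
  "eta_connection g \<xi> a c x vs = \<i> * complex_of_real (\<Sum>j\<in>UNIV. a $ j * eta g \<xi> j c x vs)"

definition nontrivial_instantons ::
    "'p chart set \<Rightarrow> 'p bifield \<Rightarrow> (3 \<Rightarrow> 'p vfield) \<Rightarrow> real \<Rightarrow> real \<Rightarrow> (real ^ 3) set" where
  "nontrivial_instantons \<A> g \<xi> t \<epsilon> =
     {a. a \<noteq> 0 \<and>
         deformed_g2_instanton \<A> (phi t \<epsilon> g \<xi>) (psi t \<epsilon> g \<xi>) (eta_connection g \<xi> a)}"

definition is_circle :: "(real ^ 3) set \<Rightarrow> bool" where
  "is_circle C \<longleftrightarrow> (\<exists>z n r. r > 0 \<and> n \<noteq> 0 \<and> C = {a \<in> sphere z r. n \<bullet> (a - z) = 0})"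

definition is_two_sphere :: "(real ^ 3) set \<Rightarrow> bool" where
  "is_two_sphere S \<longleftrightarrow> (\<exists>z r. r > 0 \<and> S = sphere z r)"

end

theory Submission
  imports Defs "HOL-Library.Function_Algebras"
begin

text \<open>At every point, \<open>\<Phi>\<^sub>i = - \<nabla>\<xi>\<^sub>i\<close> is skew and \<open>d\<eta>\<^sub>i(u, v) = - 2 g(\<Phi>\<^sub>i u, v)\<close>. Differentiating
  \<open>\<Phi>\<^sub>i \<xi>\<^sub>i = 0\<close> and \<open>\<Phi>\<^sub>i \<xi>\<^sub>j = \<xi>\<^sub>k\<close> with the Sasakian formula for \<open>\<nabla>\<Phi>\<^sub>i\<close> gives
  \<open>\<Phi>\<^sub>i\<^sup>2 = - 1\<close> and \<open>\<Phi>\<^sub>i \<Phi>\<^sub>j = \<Phi>\<^sub>k\<close> on horizontal vectors. So, for a horizontal unit vector \<open>e\<^sub>0\<close>,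
  the frame \<open>e\<^sub>0, \<Phi>\<^sub>1 e\<^sub>0, \<Phi>\<^sub>2 e\<^sub>0, \<Phi>\<^sub>3 e\<^sub>0\<close> puts the \<open>\<omega>\<^sub>i\<close> into the standard self-dual form, and
  everything reduces to exterior algebra on a 7-dimensional space. With \<open>F = dA\<close> the instanton
  equation becomes \<open>(4 |a|\<^sup>2 + 2 t\<^sup>2 \<epsilon>\<^sub>i - 1) a\<^sub>i = 0\<close> for all \<open>i\<close>, where
  \<open>(\<epsilon>\<^sub>1, \<epsilon>\<^sub>2, \<epsilon>\<^sub>3) = (\<epsilon>, \<epsilon>, 1)\<close>.\<close>

section \<open>The wedge product\<close>

text \<open>The instanton equation is an identity of 6-forms, and both of its terms are combinations
  of the three products of the horizontal volume form with \<eta>_j \<and> \<eta>_k. This is why it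
  amounts to exactly three scalar equations in three unknowns. Their factors depend on
  \<open>a\<close> only through |a|^2, so each component either vanishes or prescribes a radius; the
  shape of a solution set depends on which of these radii exist and coincide. Two objects are given
  by definite descriptions: the Christoffel symbols and the pulled-back volume form. Nothing can be
  said about them before existence and uniqueness are established, for the first through the Gram
  matrix, for the second through an expression independent of the frame. A form is moreover an
  arbitrary function on lists, so equality concerns lists of every length, including wrong degrees.
  For products of one-forms an algebraic calculus takes care of this: products of coframe elements
  are rewritten to increasing order of indices, after which only coefficients are compared.\<close>

lemma shuffle_sign_Suc_image:
  assumes "J \<subseteq> {..<n}"
  shows "shuffle_sign (Suc n) (Suc ` J) = (-1) ^ card J * (shuffle_sign n J :: 'b::comm_ring_1)"
proof -
  let ?P = "{(i, j). i \<in> J \<and> j \<in> {..<n} - J \<and> j < i}"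
  have fin: "finite J" using assms finite_subset by blast
  have finP: "finite ?P"
    by (rule finite_subset[of _ "J \<times> {..<n}"]) (use fin in auto)
  \<comment> \<open>Position 0 now belongs to the second factor and is preceded in the shuffle by
    every element of \<open>J\<close>; these \<open>card J\<close> inversions produce the extra
    sign.\<close>
  have eq: "{(i, j). i \<in> Suc ` J \<and> j \<in> {..<Suc n} - Suc ` J \<and> j < i}
     = (\<lambda>i. (Suc i, 0)) ` J \<union> map_prod Suc Suc ` ?P" (is "?L = ?R")
  proof
    show "?L \<subseteq> ?R"
    proof
      fix p assume "p \<in> ?L"
      then obtain i j where p: "p = (Suc i, j)" "i \<in> J" "j \<in> {..<Suc n} - Suc ` J" "j < Suc i"
        by auto
      show "p \<in> ?R"
      proof (cases j)
        case (Suc j')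
        then have "(i, j') \<in> ?P" using p by auto
        then show ?thesis using p Suc by (auto simp: image_iff)
      qed (use p in auto)
    qed
    show "?R \<subseteq> ?L" using assms by auto
  qed
  have "card ?R = card J + card ?P"
    by (subst card_Un_disjoint)
      (use fin finP in \<open>auto simp: card_image inj_on_def card_image[OF map_prod_inj_on]\<close>)
  then show ?thesis unfolding shuffle_sign_def eq by (simp add: power_add)
qed

lemma shuffle_sign_insert_0:
  assumes "J \<subseteq> {..<n}"
  shows "shuffle_sign (Suc n) (insert 0 (Suc ` J)) = (shuffle_sign n J :: 'b::comm_ring_1)"
proof -
  let ?P = "{(i, j). i \<in> J \<and> j \<in> {..<n} - J \<and> j < i}"
  have eq: "{(i, j). i \<in> insert 0 (Suc ` J) \<and> j \<in> {..<Suc n} - insert 0 (Suc ` J) \<and> j < i}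
     = map_prod Suc Suc ` ?P" (is "?L = ?R")
  proof
    show "?L \<subseteq> ?R"
    proof
      fix p assume "p \<in> ?L"
      then obtain i j where p: "p = (Suc i, j)" "i \<in> J" "j \<in> {..<Suc n} - Suc ` J" "j < Suc i" "j \<noteq> 0"
        by auto
      then obtain j' where "j = Suc j'" using not0_implies_Suc by blast
      then have "(i, j') \<in> ?P" using p by auto
      then show "p \<in> ?R" using p \<open>j = Suc j'\<close> by (auto simp: image_iff)
    qed
    show "?R \<subseteq> ?L" using assms by auto
  qed
  have "card ?R = card ?P" by (rule card_image) (auto simp: inj_on_def)
  then show ?thesis unfolding shuffle_sign_def eq by simp
qed

lemma Pow_lessThan_Suc:
  "Pow {..<Suc n} = (\<lambda>J. insert 0 (Suc ` J)) ` Pow {..<n} \<union> image Suc ` Pow {..<n}"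
proof -
  have "{..<Suc n} = insert 0 (Suc ` {..<n})" by (rule lessThan_Suc_eq_insert_0)
  then have "Pow {..<Suc n} = Pow (Suc ` {..<n}) \<union> insert 0 ` Pow (Suc ` {..<n})"
    by (simp only: Pow_insert)
  moreover have "Pow (Suc ` {..<n}) = image Suc ` Pow {..<n}"
    by (rule image_Pow_surj[symmetric]) simp
  ultimately show ?thesis by (simp only: image_image Un_commute)
qed

lemma wedge_Nil [simp]: "(\<alpha> \<and>\<^sub>\<Lambda> \<beta>) [] = \<alpha> [] * \<beta> []"
  by (simp add: wedge_def shuffle_sign_def)

text \<open>The sign comes from the length of the argument list, since a form need not be homogeneous
  here. This recursion takes the place of the combinatorics of shuffles in what follows.\<close>

lemma wedge_Cons:
  "(\<alpha> \<and>\<^sub>\<Lambda> \<beta>) (v # vs) = ((\<lambda>ws. \<alpha> (v # ws)) \<and>\<^sub>\<Lambda> \<beta>) vs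
     + ((\<lambda>ws. (-1) ^ length ws * \<alpha> ws) \<and>\<^sub>\<Lambda> (\<lambda>ws. \<beta> (v # ws))) vs"
proof -
  let ?n = "length vs"
  let ?f = "\<lambda>I. shuffle_sign (Suc ?n) I * \<alpha> (nths (v # vs) I) * \<beta> (nths (v # vs) ({..<Suc ?n} - I))"
  have disj: "(\<lambda>J. insert 0 (Suc ` J)) ` Pow {..<?n} \<inter> image Suc ` Pow {..<?n} = {}" by auto
  have inj1: "inj_on (\<lambda>J. insert 0 (Suc ` J)) (Pow {..<?n})"
  proof (rule inj_onI)
    fix J K :: "nat set" assume "insert 0 (Suc ` J) = insert 0 (Suc ` K)"
    then have "Suc ` J = Suc ` K" by (metis Diff_insert_absorb imageE nat.distinct(1))
    then show "J = K" by (simp add: inj_image_eq_iff)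
  qed
  have inj2: "inj_on (image Suc) (Pow {..<?n})" by (simp add: inj_on_def inj_image_eq_iff)
  have "(\<alpha> \<and>\<^sub>\<Lambda> \<beta>) (v # vs) = (\<Sum>I\<in>Pow {..<Suc ?n}. ?f I)" by (simp add: wedge_def)
  also have "\<dots> = (\<Sum>J\<in>Pow {..<?n}. ?f (insert 0 (Suc ` J))) + (\<Sum>J\<in>Pow {..<?n}. ?f (Suc ` J))"
    unfolding Pow_lessThan_Suc
    by (subst sum.union_disjoint[OF _ _ disj]) (simp_all add: sum.reindex[OF inj1] sum.reindex[OF inj2])
  also have "(\<Sum>J\<in>Pow {..<?n}. ?f (insert 0 (Suc ` J))) = ((\<lambda>ws. \<alpha> (v # ws)) \<and>\<^sub>\<Lambda> \<beta>) vs"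
    unfolding wedge_def
  proof (rule sum.cong)
    fix J assume J: "J \<in> Pow {..<?n}"
    have 1: "{j. j \<in> J} = J" "{j. j < ?n \<and> j \<notin> J} = {..<?n} - J" by auto
    show "?f (insert 0 (Suc ` J)) = shuffle_sign ?n J * \<alpha> (v # nths vs J) * \<beta> (nths vs ({..<?n} - J))"
      using J by (simp add: shuffle_sign_insert_0 nths_Cons inj_image_mem_iff 1)
  qed simp
  also have "(\<Sum>J\<in>Pow {..<?n}. ?f (Suc ` J))
     = ((\<lambda>ws. (-1) ^ length ws * \<alpha> ws) \<and>\<^sub>\<Lambda> (\<lambda>ws. \<beta> (v # ws))) vs"
    unfolding wedge_def
  proof (rule sum.cong)
    fix J assume J: "J \<in> Pow {..<?n}"
    have 1: "{j. j \<in> J} = J" "{j. j < ?n \<and> j \<notin> J} = {..<?n} - J" by auto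
    have 2: "{i. i < ?n \<and> i \<in> J} = J" using J by auto
    show "?f (Suc ` J) = shuffle_sign ?n J * ((-1) ^ length (nths vs J) * \<alpha> (nths vs J))
       * \<beta> (v # nths vs ({..<?n} - J))"
      using J by (simp add: shuffle_sign_Suc_image nths_Cons inj_image_mem_iff 1 2 length_nths image_iff mult_ac)
  qed simp
  finally show ?thesis .
qed

section \<open>Graded algebra: contraction, sign automorphism, associativity and unit\<close>

definition scale_form :: "'b::comm_ring_1 \<Rightarrow> ('v, 'b) form \<Rightarrow> ('v, 'b) form" (infixr "\<cdot>\<^sub>\<Lambda>" 75)
  where "c \<cdot>\<^sub>\<Lambda> \<alpha> = (\<lambda>vs. c * \<alpha> vs)"

definition contraction :: "'v \<Rightarrow> ('v, 'b) form \<Rightarrow> ('v, 'b) form"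
  where "contraction v \<alpha> = (\<lambda>vs. \<alpha> (v # vs))"

text \<open>The automorphism of the exterior algebra that acts as (-1)^k in degree k. It stands in
  for the sign in the antiderivation rule for \<open>contraction\<close>, which thereby makes sense
  for sums of different degrees.\<close>

definition grade_involution :: "('v, 'b::comm_ring_1) form \<Rightarrow> ('v, 'b) form"
  where "grade_involution \<alpha> = (\<lambda>vs. (-1) ^ length vs * \<alpha> vs)"

lemma scale_form_apply [simp]: "(c \<cdot>\<^sub>\<Lambda> \<alpha>) vs = c * \<alpha> vs"
  by (simp add: scale_form_def)

lemma wedge_add_left: "(\<alpha> + \<beta>) \<and>\<^sub>\<Lambda> \<gamma> = \<alpha> \<and>\<^sub>\<Lambda> \<gamma> + \<beta> \<and>\<^sub>\<Lambda> \<gamma>"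
  by (simp add: fun_eq_iff wedge_def algebra_simps sum.distrib)

lemma wedge_add_right: "\<gamma> \<and>\<^sub>\<Lambda> (\<alpha> + \<beta>) = \<gamma> \<and>\<^sub>\<Lambda> \<alpha> + \<gamma> \<and>\<^sub>\<Lambda> \<beta>"
  by (simp add: fun_eq_iff wedge_def algebra_simps sum.distrib)

lemma wedge_scale_left: "(c \<cdot>\<^sub>\<Lambda> \<alpha>) \<and>\<^sub>\<Lambda> \<gamma> = c \<cdot>\<^sub>\<Lambda> (\<alpha> \<and>\<^sub>\<Lambda> \<gamma>)"
  by (simp add: fun_eq_iff wedge_def algebra_simps sum_distrib_left)

lemma wedge_scale_right: "\<gamma> \<and>\<^sub>\<Lambda> (c \<cdot>\<^sub>\<Lambda> \<alpha>) = c \<cdot>\<^sub>\<Lambda> (\<gamma> \<and>\<^sub>\<Lambda> \<alpha>)"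
  by (simp add: fun_eq_iff wedge_def algebra_simps sum_distrib_left)

lemma wedge_minus_left: "(- \<alpha>) \<and>\<^sub>\<Lambda> \<gamma> = - (\<alpha> \<and>\<^sub>\<Lambda> \<gamma>)"
  by (simp add: fun_eq_iff wedge_def sum_negf)

lemma wedge_minus_right: "\<gamma> \<and>\<^sub>\<Lambda> (- \<alpha>) = - (\<gamma> \<and>\<^sub>\<Lambda> \<alpha>)"
  by (simp add: fun_eq_iff wedge_def sum_negf)

lemma wedge_diff_left: "(\<alpha> - \<beta>) \<and>\<^sub>\<Lambda> \<gamma> = \<alpha> \<and>\<^sub>\<Lambda> \<gamma> - \<beta> \<and>\<^sub>\<Lambda> \<gamma>"
  by (simp add: fun_eq_iff wedge_def algebra_simps sum_subtractf)

lemma wedge_diff_right: "\<gamma> \<and>\<^sub>\<Lambda> (\<alpha> - \<beta>) = \<gamma> \<and>\<^sub>\<Lambda> \<alpha> - \<gamma> \<and>\<^sub>\<Lambda> \<beta>"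
  by (simp add: fun_eq_iff wedge_def algebra_simps sum_subtractf)

lemma wedge_zero_left: "0 \<and>\<^sub>\<Lambda> \<gamma> = 0"
  by (simp add: fun_eq_iff wedge_def)

lemma wedge_zero_right: "\<gamma> \<and>\<^sub>\<Lambda> 0 = 0"
  by (simp add: fun_eq_iff wedge_def)

text \<open>Lets the curvature of an imaginary connection be written as \<i> times a real form, so
  that all products are computed over the reals.\<close>

lemma wedge_of_real:
  "(\<lambda>vs. of_real (\<alpha> vs) :: 'b::real_field) \<and>\<^sub>\<Lambda> (\<lambda>vs. of_real (\<beta> vs)) = (\<lambda>vs. of_real ((\<alpha> \<and>\<^sub>\<Lambda> \<beta>) vs))"
  by (simp add: fun_eq_iff wedge_def shuffle_sign_def)

lemma contraction_wedge:
  "contraction v (\<alpha> \<and>\<^sub>\<Lambda> \<beta>) =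
     contraction v \<alpha> \<and>\<^sub>\<Lambda> \<beta> + grade_involution \<alpha> \<and>\<^sub>\<Lambda> contraction v \<beta>"
  by (simp add: fun_eq_iff contraction_def grade_involution_def wedge_Cons)

text \<open>Each shuffle splits the list into two sublists whose lengths add up to its length, so
  the sign distributes over the two factors.\<close>

lemma grade_involution_wedge:
  "grade_involution (\<alpha> \<and>\<^sub>\<Lambda> \<beta>) = grade_involution \<alpha> \<and>\<^sub>\<Lambda> grade_involution \<beta>"
proof
  fix vs :: "'a list"
  have len: "length (nths vs I) + length (nths vs ({..<length vs} - I)) = length vs" if "I \<subseteq> {..<length vs}" for I
  proof -
    have "card {i. i < length vs \<and> i \<in> I} = card I" "{i. i < length vs \<and> i \<in> {..<length vs} - I} = {..<length vs} - I"
      using that by (auto intro: arg_cong[where f = card])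
    then show ?thesis
      using that card_mono[OF finite_lessThan that] by (simp add: length_nths card_Diff_subset finite_subset[OF that])
  qed
  show "grade_involution (\<alpha> \<and>\<^sub>\<Lambda> \<beta>) vs = (grade_involution \<alpha> \<and>\<^sub>\<Lambda> grade_involution \<beta>) vs"
    unfolding grade_involution_def wedge_def sum_distrib_left
  proof (rule sum.cong)
    fix I assume I: "I \<in> Pow {..<length vs}"
    have "((-1) ^ length vs :: 'b) = (-1) ^ length (nths vs I) * (-1) ^ length (nths vs ({..<length vs} - I))"
      using len[of I] I by (metis PowD power_add)
    then show "(-1) ^ length vs * (shuffle_sign (length vs) I * \<alpha> (nths vs I) * \<beta> (nths vs ({..<length vs} - I)))
      = shuffle_sign (length vs) I * ((-1) ^ length (nths vs I) * \<alpha> (nths vs I)) *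
          ((-1) ^ length (nths vs ({..<length vs} - I)) * \<beta> (nths vs ({..<length vs} - I)))"
      by (simp add: mult_ac)
  qed simp
qed

text \<open>Contraction with the head of the list turns both sides into sums of triple products on
  the tail, by the antiderivation rule and multiplicativity of the involution. The new factors are
  contractions and involutes of the old ones, hence the generalisation over all three forms.\<close>

lemma wedge_assoc: "(\<alpha> \<and>\<^sub>\<Lambda> \<beta>) \<and>\<^sub>\<Lambda> \<gamma> = \<alpha> \<and>\<^sub>\<Lambda> \<beta> \<and>\<^sub>\<Lambda> \<gamma>"
proof
  fix vs
  show "((\<alpha> \<and>\<^sub>\<Lambda> \<beta>) \<and>\<^sub>\<Lambda> \<gamma>) vs = (\<alpha> \<and>\<^sub>\<Lambda> \<beta> \<and>\<^sub>\<Lambda> \<gamma>) vs"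
  proof (induction vs arbitrary: \<alpha> \<beta> \<gamma>)
    case (Cons v vs)
    have *: "\<delta> (v # vs) = contraction v \<delta> vs" for \<delta> :: "('a, 'b) form"
      by (simp add: contraction_def)
    show ?case
      unfolding * by (simp add: contraction_wedge grade_involution_wedge wedge_add_left wedge_add_right Cons)
  qed (simp add: mult.assoc)
qed

lemma wedge_unit_left [simp]: "wedge_list [] \<and>\<^sub>\<Lambda> \<alpha> = \<alpha>"
proof
  fix vs
  show "(wedge_list [] \<and>\<^sub>\<Lambda> \<alpha>) vs = \<alpha> vs"
  proof (induction vs arbitrary: \<alpha>)
    case (Cons v vs)
    have "(\<lambda>ws. (-1) ^ length ws * wedge_list [] ws) = (wedge_list [] :: ('a, 'b) form)"
      "(\<lambda>ws. wedge_list [] (v # ws)) = (0 :: ('a, 'b) form)" by (auto simp: fun_eq_iff)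
    then show ?case by (simp add: wedge_Cons Cons wedge_zero_left del: wedge_list.simps)
  qed simp
qed

lemma wedge_unit_right [simp]: "\<alpha> \<and>\<^sub>\<Lambda> wedge_list [] = \<alpha>"
proof
  fix vs
  show "(\<alpha> \<and>\<^sub>\<Lambda> wedge_list []) vs = \<alpha> vs"
  proof (induction vs arbitrary: \<alpha>)
    case (Cons v vs)
    have "(\<lambda>ws. wedge_list [] (v # ws)) = (0 :: ('a, 'b) form)" by (auto simp: fun_eq_iff)
    then show ?case by (simp add: wedge_Cons Cons wedge_zero_right del: wedge_list.simps)
  qed simp
qed

section \<open>Products of one-forms\<close>

lemma one_form_simps [simp]:
  "one_form f [] = 0" "one_form f [v] = f v" "one_form f (u # v # vs) = 0"
  by (simp_all add: one_form_def)

lemma contraction_one_form: "(\<lambda>ws. one_form f (v # ws)) = f v \<cdot>\<^sub>\<Lambda> wedge_list []"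
  by (auto simp: fun_eq_iff one_form_def split: list.split)

text \<open>For a one-form the contraction is a scalar multiple of the unit and the involution is a
  sign. The rule expands a product of one-forms along its first argument, like a determinant along a
  row; values on basis vectors are computed this way.\<close>

lemma wedge_one_form_Cons:
  "(one_form f \<and>\<^sub>\<Lambda> \<beta>) (v # vs) = f v * \<beta> vs - (one_form f \<and>\<^sub>\<Lambda> (\<lambda>ws. \<beta> (v # ws))) vs"
proof -
  have "(\<lambda>ws. (-1) ^ length ws * one_form f ws) = - one_form f"
    by (auto simp: fun_eq_iff one_form_def split: list.split)
  then show ?thesis
    by (simp add: wedge_Cons contraction_one_form wedge_scale_left wedge_minus_left del: wedge_list.simps)
qed

lemma wedge_one_form_one_form_Cons:
  "(one_form f \<and>\<^sub>\<Lambda> one_form g) (v # vs) = f v * one_form g vs - g v * one_form f vs"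
  by (simp add: wedge_one_form_Cons contraction_one_form wedge_scale_right del: wedge_list.simps)

lemma wedge_one_form_degree: "length vs \<noteq> 2 \<Longrightarrow> (one_form f \<and>\<^sub>\<Lambda> one_form h) vs = 0"
  by (cases vs) (auto simp: wedge_one_form_one_form_Cons one_form_def split: list.split)

lemma one_form_anticommute: "one_form f \<and>\<^sub>\<Lambda> one_form g = - (one_form g \<and>\<^sub>\<Lambda> one_form f)"
proof
  fix vs show "(one_form f \<and>\<^sub>\<Lambda> one_form g) vs = (- (one_form g \<and>\<^sub>\<Lambda> one_form f)) vs"
    by (cases vs) (simp_all add: wedge_one_form_one_form_Cons)
qed

lemma one_form_square: "one_form f \<and>\<^sub>\<Lambda> one_form f = 0"
proof
  fix vs show "(one_form f \<and>\<^sub>\<Lambda> one_form f) vs = 0 vs"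
    by (cases vs) (simp_all add: wedge_one_form_one_form_Cons)
qed

lemma one_form_left_commute: "one_form f \<and>\<^sub>\<Lambda> one_form g \<and>\<^sub>\<Lambda> \<beta> = - (one_form g \<and>\<^sub>\<Lambda> one_form f \<and>\<^sub>\<Lambda> \<beta>)"
  by (metis one_form_anticommute wedge_assoc wedge_minus_left)

lemma one_form_left_square: "one_form f \<and>\<^sub>\<Lambda> one_form f \<and>\<^sub>\<Lambda> \<beta> = 0"
  by (metis one_form_square wedge_assoc wedge_zero_left)

lemma one_form_uminus: "one_form (\<lambda>v. - f v :: 'b::comm_ring_1) = - one_form f"
  by (auto simp: fun_eq_iff one_form_def split: list.split)

lemma one_form_scale: "one_form (\<lambda>v. c * f v) = c \<cdot>\<^sub>\<Lambda> one_form f"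
  by (auto simp: fun_eq_iff one_form_def split: list.split)

section \<open>Coframes and the standard forms on a 7-dimensional space\<close>

lemma wedge_map: "(\<alpha> \<and>\<^sub>\<Lambda> \<beta>) (map L vs) = ((\<lambda>ws. \<alpha> (map L ws)) \<and>\<^sub>\<Lambda> (\<lambda>ws. \<beta> (map L ws))) vs"
  by (simp add: wedge_def nths_map)

lemma one_form_map: "one_form f (map L vs) = one_form (\<lambda>v. f (L v)) vs"
  by (auto simp: one_form_def split: list.split)

lemma dx_map: "dx is (map L vs) = wedge_list (map (\<lambda>i. one_form (\<lambda>v. L v $ i)) is) vs"
proof -
  have "wedge_list \<alpha>s (map L vs) = wedge_list (map (\<lambda>\<alpha> vs. \<alpha> (map L vs)) \<alpha>s) vs" for \<alpha>s :: "(real ^ 7, real) form list"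
    by (induction \<alpha>s arbitrary: vs) (simp_all add: wedge_map)
  then show ?thesis
    by (simp add: dx_def comp_def one_form_map)
qed

lemma wedge_list_Cons_Cons: "wedge_list (\<alpha> # \<beta> # \<alpha>s) = \<alpha> \<and>\<^sub>\<Lambda> wedge_list (\<beta> # \<alpha>s)" 
  by simp

lemma wedge_list_single: "wedge_list [\<alpha>] = \<alpha>"
  using wedge_unit_right[of \<alpha>] by simp

text \<open>The condition \<open>j < i\<close> orients the rule: only factors that are out of order
  get swapped, so rewriting terminates with increasing indices.\<close>

lemma coframe_reorder:
  assumes "j < (i::nat)"
  shows "one_form (\<theta> i) \<and>\<^sub>\<Lambda> one_form (\<theta> j) = - (one_form (\<theta> j) \<and>\<^sub>\<Lambda> one_form (\<theta> i))"
    "one_form (\<theta> i) \<and>\<^sub>\<Lambda> one_form (\<theta> j) \<and>\<^sub>\<Lambda> \<beta> = - (one_form (\<theta> j) \<and>\<^sub>\<Lambda> one_form (\<theta> i) \<and>\<^sub>\<Lambda> \<beta>)"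
  by (rule one_form_anticommute one_form_left_commute)+

text \<open>As rewrite rules these distribute products, sort every monomial by index and delete
  those with a repeated index. An identity of forms in a coframe becomes arithmetic of
  coefficients.\<close>

lemmas wedge_expand =
  wedge_assoc wedge_add_left wedge_add_right wedge_minus_left wedge_minus_right
  wedge_scale_left wedge_scale_right wedge_zero_left wedge_zero_right wedge_diff_left wedge_diff_right
  coframe_reorder one_form_square one_form_left_square

text \<open>Indices \<open>0, \<dots>, 3\<close> of a coframe are horizontal, and \<open>4, 5, 6\<close> stand for \<open>\<eta>\<^sub>1, \<eta>\<^sub>2, \<eta>\<^sub>3\<close>.\<close>

definition self_dual :: "(nat \<Rightarrow> ('v, 'b::comm_ring_1) form) \<Rightarrow> 'b \<Rightarrow> 'b \<Rightarrow> 'b \<Rightarrow> ('v, 'b) form" where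
  "self_dual E p q r = p \<cdot>\<^sub>\<Lambda> (E 0 \<and>\<^sub>\<Lambda> E 1 + E 2 \<and>\<^sub>\<Lambda> E 3) + q \<cdot>\<^sub>\<Lambda> (E 0 \<and>\<^sub>\<Lambda> E 2 + E 3 \<and>\<^sub>\<Lambda> E 1)
     + r \<cdot>\<^sub>\<Lambda> (E 0 \<and>\<^sub>\<Lambda> E 3 + E 1 \<and>\<^sub>\<Lambda> E 2)"

text \<open>The three basic self-dual forms square to twice the volume monomial and have vanishing
  mutual products, so no mixed terms remain.\<close>

lemma self_dual_square:
  fixes \<theta> :: "nat \<Rightarrow> 'v \<Rightarrow> real"
  defines "E \<equiv> \<lambda>k. one_form (\<theta> k)"
  shows "self_dual E p q r \<and>\<^sub>\<Lambda> self_dual E p q r = (2 * (p\<^sup>2 + q\<^sup>2 + r\<^sup>2)) \<cdot>\<^sub>\<Lambda> wedge_list (map E [0, 1, 2, 3])"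
  unfolding self_dual_def E_def list.map wedge_list_Cons_Cons wedge_list_single
  by (rule ext) (simp add: wedge_expand algebra_simps power2_eq_square del: wedge_list.simps)

lemma self_dual_degree:
  "length vs \<noteq> 2 \<Longrightarrow> self_dual (\<lambda>k. one_form (\<theta> k)) p q r vs = 0"
  by (simp add: self_dual_def wedge_one_form_degree)

text \<open>In an adapted frame, -2 times \<open>self_dual E p q r + vertical E p q r\<close> is the
  exterior derivative of p \<eta>_1 + q \<eta>_2 + r \<eta>_3; \<open>vertical\<close> collects the
  terms \<eta>_j \<and> \<eta>_k of the structure equations.\<close>

definition vertical :: "(nat \<Rightarrow> ('v, 'b::comm_ring_1) form) \<Rightarrow> 'b \<Rightarrow> 'b \<Rightarrow> 'b \<Rightarrow> ('v, 'b) form" where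
  "vertical E p q r = p \<cdot>\<^sub>\<Lambda> (E 5 \<and>\<^sub>\<Lambda> E 6) + q \<cdot>\<^sub>\<Lambda> (E 6 \<and>\<^sub>\<Lambda> E 4) + r \<cdot>\<^sub>\<Lambda> (E 4 \<and>\<^sub>\<Lambda> E 5)"

text \<open>Write \<open>F\<close> as -2 (s + v) with s self-dual and v vertical. Then s^3 = 0 in
  four horizontal directions and v^2 = 0 in three vertical ones, so only 3 s^2 v survives; as s^2 is
  2 (p^2 + q^2 + r^2) times the volume, the constant is -8 * 3 * 2 = -48.\<close>

lemma curvature_cube:
  fixes \<theta> :: "nat \<Rightarrow> 'v \<Rightarrow> real" and p q r :: real
  defines "E \<equiv> \<lambda>k. one_form (\<theta> k)"
  defines "F \<equiv> (- 2) \<cdot>\<^sub>\<Lambda> (self_dual E p q r + vertical E p q r)"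
  shows "F \<and>\<^sub>\<Lambda> F \<and>\<^sub>\<Lambda> F =
    (- 48 * (p\<^sup>2 + q\<^sup>2 + r\<^sup>2)) \<cdot>\<^sub>\<Lambda> (wedge_list (map E [0, 1, 2, 3]) \<and>\<^sub>\<Lambda> vertical E p q r)"
  unfolding self_dual_def vertical_def E_def F_def list.map wedge_list_Cons_Cons wedge_list_single
  by (rule ext) (simp add: wedge_expand algebra_simps power2_eq_square del: wedge_list.simps)

text \<open>The vertical part meets only the volume form and contributes -2. The self-dual part
  meets only the mixed terms, where -2 * (-t^2) and the square of a basic self-dual form give 4 t^2,
  with the sign \<epsilon> in the first two directions.\<close>

lemma curvature_wedge_psi:
  fixes \<theta> :: "nat \<Rightarrow> 'v \<Rightarrow> real" and p q r :: real
  defines "E \<equiv> \<lambda>k. one_form (\<theta> k)"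
  defines "F \<equiv> (- 2) \<cdot>\<^sub>\<Lambda> (self_dual E p q r + vertical E p q r)"
  shows "F \<and>\<^sub>\<Lambda> (wedge_list (map E [0, 1, 2, 3]) + - (t\<^sup>2) \<cdot>\<^sub>\<Lambda> 
      (\<epsilon> \<cdot>\<^sub>\<Lambda> ((E 5 \<and>\<^sub>\<Lambda> E 6) \<and>\<^sub>\<Lambda> self_dual E 1 0 0) + \<epsilon> \<cdot>\<^sub>\<Lambda> ((E 6 \<and>\<^sub>\<Lambda> E 4) \<and>\<^sub>\<Lambda> self_dual E 0 1 0)
        + (E 4 \<and>\<^sub>\<Lambda> E 5) \<and>\<^sub>\<Lambda> self_dual E 0 0 1))
    = wedge_list (map E [0, 1, 2, 3]) \<and>\<^sub>\<Lambda>
        vertical E ((4 * t\<^sup>2 * \<epsilon> - 2) * p) ((4 * t\<^sup>2 * \<epsilon> - 2) * q) ((4 * t\<^sup>2 - 2) * r)"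
  unfolding self_dual_def vertical_def E_def F_def list.map wedge_list_Cons_Cons wedge_list_single
  by (rule ext) (simp add: wedge_expand algebra_simps power2_eq_square del: wedge_list.simps)

text \<open>Evaluation on the four horizontal dual vectors followed by two vertical ones isolates a
  single coefficient.\<close>

lemma horizontal_volume_wedge_vertical_eq_0_iff:
  fixes \<theta> :: "nat \<Rightarrow> 'v \<Rightarrow> real" and p q r :: real
  assumes dual: "\<And>k l. k < 7 \<Longrightarrow> l < 7 \<Longrightarrow> \<theta> k (b l) = (if k = l then 1 else 0)"
  defines "E \<equiv> \<lambda>k. one_form (\<theta> k)"
  shows "wedge_list (map E [0, 1, 2, 3]) \<and>\<^sub>\<Lambda> vertical E p q r = 0 \<longleftrightarrow> p = 0 \<and> q = 0 \<and> r = 0"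
    (is "?\<alpha> = 0 \<longleftrightarrow> ?zero")
proof
  assume 0: "?\<alpha> = 0"
  have "?\<alpha> [b 0, b 1, b 2, b 3, b 5, b 6] = p" "?\<alpha> [b 0, b 1, b 2, b 3, b 6, b 4] = q"
    "?\<alpha> [b 0, b 1, b 2, b 3, b 4, b 5] = r"
    unfolding vertical_def E_def list.map wedge_list_Cons_Cons wedge_list_single
    by (simp_all add: wedge_assoc wedge_add_right wedge_scale_right wedge_one_form_Cons dual del: wedge_list.simps)
  with 0 show ?zero by simp
qed (simp add: vertical_def fun_eq_iff wedge_def)

text \<open>The signs are such that \<open>dx\<^sub>4\<^sub>5 + dx\<^sub>6\<^sub>7 = - \<omega>\<^sub>1\<close>, \<open>dx\<^sub>4\<^sub>6 - dx\<^sub>5\<^sub>7 = - \<omega>\<^sub>2\<close> and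
  \<open>- dx\<^sub>4\<^sub>7 - dx\<^sub>5\<^sub>6 = - \<omega>\<^sub>3\<close>, the coefficients of \<open>dx\<^sub>1, dx\<^sub>2, dx\<^sub>3\<close> in \<^const>\<open>standard_phi\<close>.\<close>

definition g2_coordinates :: "real \<Rightarrow> real \<Rightarrow> (nat \<Rightarrow> 'v \<Rightarrow> real) \<Rightarrow> 'v \<Rightarrow> real ^ 7" where
  "g2_coordinates t \<epsilon> \<theta> v = vector [t * \<theta> 4 v, t * \<theta> 5 v, \<epsilon> * t * \<theta> 6 v, \<theta> 0 v, - \<theta> 1 v, - \<theta> 2 v, \<theta> 3 v]"

lemma g2_coordinates_nth:
  "g2_coordinates t \<epsilon> \<theta> v $ 1 = t * \<theta> 4 v" "g2_coordinates t \<epsilon> \<theta> v $ 2 = t * \<theta> 5 v"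
  "g2_coordinates t \<epsilon> \<theta> v $ 3 = (\<epsilon> * t) * \<theta> 6 v" "g2_coordinates t \<epsilon> \<theta> v $ 4 = \<theta> 0 v"
  "g2_coordinates t \<epsilon> \<theta> v $ 5 = - \<theta> 1 v" "g2_coordinates t \<epsilon> \<theta> v $ 6 = - \<theta> 2 v"
  "g2_coordinates t \<epsilon> \<theta> v $ 7 = \<theta> 3 v"
  by (simp_all add: g2_coordinates_def vector_def)

lemma standard_phi_g2_coordinates:
  fixes \<theta> :: "nat \<Rightarrow> 'v \<Rightarrow> real" and t \<epsilon> :: real
  defines "E \<equiv> \<lambda>k. one_form (\<theta> k)"
  shows "standard_phi (map (g2_coordinates t \<epsilon> \<theta>) vs) =
    \<epsilon> * t ^ 3 * (E 4 \<and>\<^sub>\<Lambda> E 5 \<and>\<^sub>\<Lambda> E 6) vs - t * ((E 4 \<and>\<^sub>\<Lambda> self_dual E 1 0 0) vs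
     + (E 5 \<and>\<^sub>\<Lambda> self_dual E 0 1 0) vs + \<epsilon> * (E 6 \<and>\<^sub>\<Lambda> self_dual E 0 0 1) vs)"
  unfolding standard_phi_def dx_map self_dual_def E_def list.map wedge_list_Cons_Cons wedge_list_single
    g2_coordinates_nth one_form_uminus one_form_scale
  by (simp add: wedge_expand algebra_simps power3_eq_cube del: wedge_list.simps)

lemma standard_psi_g2_coordinates:
  fixes \<theta> :: "nat \<Rightarrow> 'v \<Rightarrow> real" and t \<epsilon> :: real
  defines "E \<equiv> \<lambda>k. one_form (\<theta> k)"
  shows "standard_psi (map (g2_coordinates t \<epsilon> \<theta>) vs) =
    wedge_list (map E [0, 1, 2, 3]) vs
      - t\<^sup>2 * (\<epsilon> * ((E 5 \<and>\<^sub>\<Lambda> E 6) \<and>\<^sub>\<Lambda> self_dual E 1 0 0) vs + \<epsilon> * ((E 6 \<and>\<^sub>\<Lambda> E 4) \<and>\<^sub>\<Lambda> self_dual E 0 1 0) vs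
        + ((E 4 \<and>\<^sub>\<Lambda> E 5) \<and>\<^sub>\<Lambda> self_dual E 0 0 1) vs)"
  unfolding standard_psi_def dx_map self_dual_def E_def list.map wedge_list_Cons_Cons wedge_list_single
    g2_coordinates_nth one_form_uminus one_form_scale
  by (simp add: wedge_expand algebra_simps power2_eq_square del: wedge_list.simps)

section \<open>Derivatives of linear families\<close>

lemma smooth_on_differentiable:
  assumes "smooth_on S f" "x \<in> S"
  shows "f differentiable (at x)"
  using assms unfolding smooth_on_def by (metis Ck_on.simps(2))

lemma smooth_on_directional:
  assumes "smooth_on S f"
  shows "smooth_on S (\<lambda>x. directional f x v)"
  using assms unfolding smooth_on_def by (metis Ck_on.simps(2))

lemma has_derivative_directional:
  "f differentiable (at x) \<Longrightarrow> (f has_derivative (\<lambda>u. directional f x u)) (at x)"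
  by (simp add: frechet_derivative_works)

text \<open>Differentiability of \<open>A\<close> is known only for fixed second argument; expanding
  \<open>W y\<close> in the basis makes \<open>A y (W y)\<close> a finite sum of products, to which
  the product rule applies. Linearity is available on \<open>S\<close> alone, so the derivative is
  transported within this open set.\<close>

lemma has_derivative_linear_family:
  fixes A :: "'a::real_normed_vector \<Rightarrow> 'v::euclidean_space \<Rightarrow> 'w::real_normed_vector"
  assumes S: "open S" "x \<in> S"
    and lin: "\<And>y. y \<in> S \<Longrightarrow> linear (A y)"
    and A: "\<And>w. (\<lambda>y. A y w) differentiable (at x)"
    and W: "W differentiable (at x)"
  shows "((\<lambda>y. A y (W y)) has_derivative
    (\<lambda>u. directional (\<lambda>y. A y (W x)) x u + A x (directional W x u))) (at x)"
proof -
  have expand: "A y w = (\<Sum>b\<in>Basis. (w \<bullet> b) *\<^sub>R A y b)" if "y \<in> S" for y w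
  proof -
    have "A y w = A y (\<Sum>b\<in>Basis. (w \<bullet> b) *\<^sub>R b)" by (simp add: euclidean_representation)
    then show ?thesis using lin[OF that] by (simp add: linear_sum linear_scale)
  qed
  have dA: "((\<lambda>y. A y w) has_derivative (\<lambda>u. directional (\<lambda>y. A y w) x u)) (at x)" for w
    using A by (rule has_derivative_directional)
  have dW: "(W has_derivative (\<lambda>u. directional W x u)) (at x)"
    using W by (rule has_derivative_directional)
  have frozen: "directional (\<lambda>y. A y w) x u = (\<Sum>b\<in>Basis. (w \<bullet> b) *\<^sub>R directional (\<lambda>y. A y b) x u)" for w u
  proof -
    have "((\<lambda>y. \<Sum>b\<in>Basis. (w \<bullet> b) *\<^sub>R A y b) has_derivative
       (\<lambda>u. \<Sum>b\<in>Basis. (w \<bullet> b) *\<^sub>R directional (\<lambda>y. A y b) x u)) (at x)"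
      by (intro has_derivative_sum has_derivative_scaleR_right dA)
    then have "((\<lambda>y. A y w) has_derivative
       (\<lambda>u. \<Sum>b\<in>Basis. (w \<bullet> b) *\<^sub>R directional (\<lambda>y. A y b) x u)) (at x)"
      by (rule has_derivative_transform_within_open[OF _ S]) (simp add: expand[symmetric])
    from has_derivative_unique[OF dA this] show ?thesis by metis
  qed
  have "((\<lambda>y. \<Sum>b\<in>Basis. (W y \<bullet> b) *\<^sub>R A y b) has_derivative
     (\<lambda>u. \<Sum>b\<in>Basis. (W x \<bullet> b) *\<^sub>R directional (\<lambda>y. A y b) x u + (directional W x u \<bullet> b) *\<^sub>R A x b)) (at x)"
    by (intro has_derivative_sum has_derivative_scaleR has_derivative_inner_left dA dW)
  then have "((\<lambda>y. A y (W y)) has_derivative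
     (\<lambda>u. \<Sum>b\<in>Basis. (W x \<bullet> b) *\<^sub>R directional (\<lambda>y. A y b) x u + (directional W x u \<bullet> b) *\<^sub>R A x b)) (at x)"
    by (rule has_derivative_transform_within_open[OF _ S]) (simp add: expand[symmetric])
  moreover have "(\<Sum>b\<in>Basis. (W x \<bullet> b) *\<^sub>R directional (\<lambda>y. A y b) x u + (directional W x u \<bullet> b) *\<^sub>R A x b)
     = directional (\<lambda>y. A y (W x)) x u + A x (directional W x u)" for u
    by (simp add: sum.distrib frozen[symmetric] expand[OF S(2), symmetric])
  ultimately show ?thesis by simp
qed

lemma directional_linear_family:
  fixes A :: "'a::real_normed_vector \<Rightarrow> 'v::euclidean_space \<Rightarrow> 'w::real_normed_vector"
  assumes "open S" "x \<in> S" "\<And>y. y \<in> S \<Longrightarrow> linear (A y)" "\<And>w. (\<lambda>y. A y w) differentiable (at x)"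
    "W differentiable (at x)"
  shows "directional (\<lambda>y. A y (W y)) x u = directional (\<lambda>y. A y (W x)) x u + A x (directional W x u)"
  using frechet_derivative_at[OF has_derivative_linear_family[OF assms]] by metis

lemma directional_cong:
  assumes "open S" "x \<in> S" "\<And>y. y \<in> S \<Longrightarrow> f y = h y" "f differentiable (at x)"
  shows "directional f x = directional h x" "h differentiable (at x)"
proof -
  have "(h has_derivative directional f x) (at x)"
    using has_derivative_transform_within_open[OF has_derivative_directional[OF assms(4)] assms(1,2)] assms(3)
    by simp
  then show "h differentiable (at x)" "directional f x = directional h x"
    using frechet_derivative_at differentiable_def by blast+
qed

lemma differentiable_prod:
  fixes f :: "'i \<Rightarrow> 'a::real_normed_vector \<Rightarrow> 'b::real_normed_field"
  assumes "\<And>i. i \<in> I \<Longrightarrow> f i differentiable (at x)"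
  shows "(\<lambda>y. \<Prod>i\<in>I. f i y) differentiable (at x)"
  using assms
proof (induction I rule: infinite_finite_induct)
  case (insert i I)
  then show ?case by (simp add: differentiable_mult)
qed auto

lemma differentiable_det:
  fixes M :: "'a::real_normed_vector \<Rightarrow> real ^ 'n ^ 'n"
  assumes "\<And>i j. (\<lambda>y. M y $ i $ j) differentiable (at x)"
  shows "(\<lambda>y. det (M y)) differentiable (at x)"
  unfolding det_def
proof (rule differentiable_sum)
  show "\<forall>p\<in>{p. p permutes UNIV}. (\<lambda>y. of_int (sign p) * (\<Prod>i\<in>UNIV. M y $ i $ p i)) differentiable (at x)"
    by (intro ballI differentiable_mult differentiable_prod differentiable_const assms)
qed (simp add: finite_permutations)

lemma differentiable_linear_solve:
  fixes M :: "'a::real_normed_vector \<Rightarrow> real ^ 'n ^ 'n"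
  assumes S: "open S" "x \<in> S"
    and M: "\<And>i j. (\<lambda>y. M y $ i $ j) differentiable (at x)" "\<And>y. y \<in> S \<Longrightarrow> det (M y) \<noteq> 0"
    and b: "\<And>i. (\<lambda>y. b y $ i) differentiable (at x)"
    and w: "\<And>y. y \<in> S \<Longrightarrow> M y *v w y = b y"
  shows "w differentiable (at x)"
proof -
  let ?c = "\<lambda>k y. det (\<chi> i j. if j = k then b y $ i else M y $ i $ j) / det (M y)"
  have "(?c k) differentiable (at x)" for k
  proof (intro differentiable_divide differentiable_det)
    show "(\<lambda>y. (\<chi> i j. if j = k then b y $ i else M y $ i $ j) $ i $ j) differentiable (at x)" for i j
      using M(1) b by (cases "j = k") simp_all
  qed (use M S in auto)
  then have diff: "(\<lambda>y. \<Sum>k\<in>UNIV. ?c k y *\<^sub>R axis k (1::real)) differentiable (at x)"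
    by (intro differentiable_sum ballI differentiable_scaleR differentiable_const) simp_all
  have "(\<Sum>k\<in>UNIV. ?c k y *\<^sub>R axis k 1) = w y" if "y \<in> S" for y
  proof -
    have eq: "w y = (\<chi> k. ?c k y)" using cramer[OF M(2)[OF that]] w[OF that] by blast
    have "w y $ k = ?c k y" for k by (subst eq) (rule vec_lambda_beta)
    then have "(\<Sum>k\<in>UNIV. ?c k y *\<^sub>R axis k 1) = (\<Sum>k\<in>UNIV. w y $ k *s axis k 1)"
      by (simp only: scalar_mult_eq_scaleR)
    then show ?thesis by (simp only: basis_expansion)
  qed
  from directional_cong(2)[OF S this diff] show ?thesis by simp
qed

section \<open>The Levi-Civita connection in a chart\<close>

lemma linear_eq_sum_axis:
  fixes f :: "vec7 \<Rightarrow> real"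
  assumes "linear f"
  shows "f w = (\<Sum>j\<in>UNIV. f (axis j 1) * w $ j)"
proof -
  have "f w = f (\<Sum>j\<in>UNIV. w $ j *\<^sub>R axis j 1)"
    using basis_expansion[of w] by (simp only: scalar_mult_eq_scaleR)
  then show ?thesis using assms by (simp add: linear_sum linear_scale mult.commute)
qed

lemma linear_directional: "f differentiable (at x) \<Longrightarrow> linear (directional f x)"
  by (rule has_derivative_linear[OF has_derivative_directional])

locale metric_chart =
  fixes S :: "vec7 set" and G :: "vec7 \<Rightarrow> vec7 \<Rightarrow> vec7 \<Rightarrow> real"
  assumes open_S: "open S"
    and smooth_G: "\<And>u v. smooth_on S (\<lambda>x. G x u v)"
    and bilinear_G: "\<And>x. x \<in> S \<Longrightarrow> bilinear (G x)"
    and sym_G: "\<And>x u v. x \<in> S \<Longrightarrow> G x u v = G x v u"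
    and pos_G: "\<And>x u. x \<in> S \<Longrightarrow> u \<noteq> 0 \<Longrightarrow> G x u u > 0"
begin

lemma G_linear:
  assumes "x \<in> S"
  shows "linear (\<lambda>u. G x u v)" "linear (G x u)"
  using bilinear_G[OF assms] unfolding bilinear_def by blast+

lemma G_simps:
  assumes "x \<in> S"
  shows "G x (u + v) w = G x u w + G x v w" "G x w (u + v) = G x w u + G x w v"
    "G x (u - v) w = G x u w - G x v w" "G x w (u - v) = G x w u - G x w v"
    "G x (- u) w = - G x u w" "G x w (- u) = - G x w u"
    "G x (r *\<^sub>R u) w = r * G x u w" "G x w (r *\<^sub>R u) = r * G x w u"
    "G x 0 w = 0" "G x w 0 = 0"
  using G_linear(1)[OF assms, of w] G_linear(2)[OF assms, of w]
  by (simp_all add: linear_add[of "\<lambda>u. G x u w"] linear_diff[of "\<lambda>u. G x u w"] linear_neg[of "\<lambda>u. G x u w"]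
      linear_scale[of "\<lambda>u. G x u w"] linear_0[of "\<lambda>u. G x u w"] linear_add linear_diff linear_neg linear_scale linear_0)

lemma G_eqI:
  assumes "x \<in> S" "\<And>z. G x u z = G x v z"
  shows "u = v"
proof (rule ccontr)
  assume "u \<noteq> v"
  then have "G x (u - v) (u - v) > 0" using pos_G[OF assms(1)] by simp
  then show False using assms by (simp add: G_simps)
qed

definition gram :: "vec7 \<Rightarrow> real ^ 7 ^ 7" where
  "gram x = (\<chi> i j. G x (axis j 1) (axis i 1))"

lemma gram_mult:
  assumes "x \<in> S"
  shows "gram x *v w = (\<chi> i. G x w (axis i 1))"
  unfolding gram_def matrix_vector_mult_def
  by (simp add: linear_eq_sum_axis[OF G_linear(1)[OF assms], of w, symmetric])

lemma gram_eq_iff: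
  assumes "x \<in> S" "linear f"
  shows "gram x *v w = (\<chi> i. f (axis i 1)) \<longleftrightarrow> (\<forall>z. G x w z = f z)"
proof
  assume "gram x *v w = (\<chi> i. f (axis i 1))"
  then have "G x w (axis i 1) = f (axis i 1)" for i
    by (simp add: gram_mult[OF assms(1)] vec_eq_iff)
  then show "\<forall>z. G x w z = f z"
    by (subst linear_eq_sum_axis[OF assms(2)], subst linear_eq_sum_axis[OF G_linear(2)[OF assms(1)]]) simp
qed (simp add: gram_mult[OF assms(1)])

lemma det_gram_nonzero:
  assumes "x \<in> S"
  shows "det (gram x) \<noteq> 0"
proof -
  have "inj ((*v) (gram x))"
  proof (rule injI)
    fix u v assume "gram x *v u = gram x *v v"
    then have *: "G x u (axis i 1) = G x v (axis i 1)" for i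
      by (simp add: gram_mult[OF assms] vec_eq_iff)
    show "u = v"
    proof (rule G_eqI[OF assms])
      show "G x u z = G x v z" for z
        using linear_eq_sum_axis[OF G_linear(2)[OF assms], of u z]
          linear_eq_sum_axis[OF G_linear(2)[OF assms], of v z] by (simp add: *)
    qed
  qed
  then show ?thesis
    using invertible_det_nz[of "gram x"] invertible_left_inverse[of "gram x"]
      matrix_left_invertible_injective[of "gram x"] by simp
qed

lemma riesz:
  assumes "x \<in> S" "linear f"
  shows "\<exists>!w. \<forall>z. G x w z = f z"
  unfolding gram_eq_iff[OF assms, symmetric] cramer[OF det_gram_nonzero[OF assms(1)]] by simp

lemma G_differentiable: "x \<in> S \<Longrightarrow> (\<lambda>y. G y u v) differentiable (at x)"
  by (rule smooth_on_differentiable[OF smooth_G])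

lemma linear_directional_family:
  fixes A :: "vec7 \<Rightarrow> vec7 \<Rightarrow> real"
  assumes "x \<in> S" "\<And>y. y \<in> S \<Longrightarrow> linear (A y)" "\<And>w. (\<lambda>y. A y w) differentiable (at x)"
  shows "linear (\<lambda>w. directional (\<lambda>y. A y w) x u)"
proof (rule linearI)
  have d: "((\<lambda>y. A y w) has_derivative (\<lambda>u. directional (\<lambda>y. A y w) x u)) (at x)" for w
    using assms(3) by (rule has_derivative_directional)
  fix v w :: vec7 and r :: real
  have "((\<lambda>y. A y v + A y w) has_derivative (\<lambda>u. directional (\<lambda>y. A y v) x u + directional (\<lambda>y. A y w) x u)) (at x)"
    by (intro has_derivative_add d)
  then have "((\<lambda>y. A y (v + w)) has_derivative (\<lambda>u. directional (\<lambda>y. A y v) x u + directional (\<lambda>y. A y w) x u)) (at x)"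
    by (rule has_derivative_transform_within_open[OF _ open_S assms(1)]) (simp add: linear_add[OF assms(2)])
  from has_derivative_unique[OF d this]
  show "directional (\<lambda>y. A y (v + w)) x u = directional (\<lambda>y. A y v) x u + directional (\<lambda>y. A y w) x u" by metis
  have "((\<lambda>y. r *\<^sub>R A y v) has_derivative (\<lambda>u. r *\<^sub>R directional (\<lambda>y. A y v) x u)) (at x)"
    by (intro has_derivative_scaleR_right d)
  then have "((\<lambda>y. A y (r *\<^sub>R v)) has_derivative (\<lambda>u. r *\<^sub>R directional (\<lambda>y. A y v) x u)) (at x)"
    by (rule has_derivative_transform_within_open[OF _ open_S assms(1)]) (simp add: linear_scale[OF assms(2)])
  from has_derivative_unique[OF d this]
  show "directional (\<lambda>y. A y (r *\<^sub>R v)) x u = r *\<^sub>R directional (\<lambda>y. A y v) x u" by metis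
qed

lemma linear_directional_G:
  assumes x: "x \<in> S"
  shows "linear (\<lambda>w. directional (\<lambda>y. G y w v) x u)" "linear (\<lambda>w. directional (\<lambda>y. G y v w) x u)"
proof -
  show "linear (\<lambda>w. directional (\<lambda>y. G y w v) x u)"
    by (rule linear_directional_family[OF x, of "\<lambda>y w. G y w v"]) (rule G_linear G_differentiable x, assumption?)+
  show "linear (\<lambda>w. directional (\<lambda>y. G y v w) x u)"
    by (rule linear_directional_family[OF x, of "\<lambda>y. G y v"]) (rule G_linear G_differentiable x, assumption?)+
qed

lemma directional_G_sym: "x \<in> S \<Longrightarrow> directional (\<lambda>y. G y u v) x = directional (\<lambda>y. G y v u) x"
  by (rule directional_cong(1)[OF open_S, of x "\<lambda>y. G y u v"]) (simp_all add: sym_G G_differentiable)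

text \<open>Justifies the definite description in \<open>christoffel\<close>: the Koszul expression
  is linear in \<open>z\<close>, so \<open>riesz\<close> supplies a unique representing vector.
  Symmetry, linearity and metric compatibility are all derived from this equation.\<close>

lemma christoffel_koszul:
  assumes "x \<in> S"
  shows "2 * G x (christoffel G x u v) z = directional (\<lambda>y. G y v z) x u
      + directional (\<lambda>y. G y u z) x v - directional (\<lambda>y. G y u v) x z"
proof -
  let ?f = "\<lambda>z. directional (\<lambda>y. G y v z) x u + directional (\<lambda>y. G y u z) x v - directional (\<lambda>y. G y u v) x z"
  have "linear ?f"
    using linear_directional_G[OF assms] linear_directional[OF G_differentiable[OF assms]]
    by (intro linear_compose_add linear_compose_sub) 
  then have "linear (\<lambda>z. (1 / 2) *\<^sub>R ?f z)"
    by (intro linear_compose_scale_right)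
  from riesz[OF assms this] have "\<exists>!w. \<forall>z. 2 * G x w z = ?f z"
    by (simp add: field_simps)
  from theI'[OF this, folded christoffel_def] show ?thesis ..
qed

lemma christoffel_sym: "x \<in> S \<Longrightarrow> christoffel G x u v = christoffel G x v u"
proof (rule G_eqI)
  fix z assume x: "x \<in> S"
  show "G x (christoffel G x u v) z = G x (christoffel G x v u) z"
    using christoffel_koszul[OF x, of u v z] christoffel_koszul[OF x, of v u z] directional_G_sym[OF x, of u v]
    by simp
qed

lemma christoffel_linear: "x \<in> S \<Longrightarrow> linear (christoffel G x u)"
proof (rule linearI)
  assume x: "x \<in> S"
  note lin = linear_directional_G[OF x] linear_directional[OF G_differentiable[OF x]]
  fix v w r
  show "christoffel G x u (v + w) = christoffel G x u v + christoffel G x u w"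
  proof (rule G_eqI[OF x])
    fix z
    show "G x (christoffel G x u (v + w)) z = G x (christoffel G x u v + christoffel G x u w) z"
      using christoffel_koszul[OF x, of u "v + w" z] christoffel_koszul[OF x, of u v z]
        christoffel_koszul[OF x, of u w z]
      by (simp add: G_simps[OF x] linear_add[OF lin(1)] linear_add[OF lin(2)] linear_add[OF lin(3)])
  qed
  show "christoffel G x u (r *\<^sub>R v) = r *\<^sub>R christoffel G x u v"
  proof (rule G_eqI[OF x])
    fix z
    have "2 * G x (christoffel G x u (r *\<^sub>R v)) z = r * (2 * G x (christoffel G x u v) z)"
      unfolding christoffel_koszul[OF x]
      by (simp add: linear_scale[OF lin(1)] linear_scale[OF lin(2)] linear_scale[OF lin(3)] algebra_simps)
    then show "G x (christoffel G x u (r *\<^sub>R v)) z = G x (r *\<^sub>R christoffel G x u v) z"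
      by (simp add: G_simps[OF x])
  qed
qed

text \<open>Adding the Koszul formulas with \<open>v\<close> and \<open>w\<close> exchanged cancels
  everything except the derivative along \<open>u\<close>, which appears twice.\<close>

lemma metric_compatible:
  assumes "x \<in> S"
  shows "directional (\<lambda>y. G y v w) x u = G x (christoffel G x u v) w + G x v (christoffel G x u w)"
  using christoffel_koszul[OF assms, of u v w] christoffel_koszul[OF assms, of u w v]
    directional_G_sym[OF assms, of v w] directional_G_sym[OF assms, of w u] directional_G_sym[OF assms, of v u]
    sym_G[OF assms, of v]
  by simp

lemma G_pairing_differentiable:
  assumes "x \<in> S" "V differentiable (at x)" "W differentiable (at x)"
  shows "(\<lambda>y. G y (V y) (W y)) differentiable (at x)"
    and "directional (\<lambda>y. G y (V y) (W y)) x u =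
      directional (\<lambda>y. G y (V x) (W x)) x u + G x (directional V x u) (W x) + G x (V x) (directional W x u)"
proof -
  have 1: "(\<lambda>y. G y (V y) w) differentiable (at x)" for w
    by (rule differentiableI[OF has_derivative_linear_family[OF open_S assms(1), of "\<lambda>y v. G y v w", OF _ _ assms(2)]])
      (use G_linear G_differentiable assms(1) in auto)
  have 2: "directional (\<lambda>y. G y (V y) w) x u = directional (\<lambda>y. G y (V x) w) x u + G x (directional V x u) w" for w
    by (rule directional_linear_family[OF open_S assms(1), of "\<lambda>y v. G y v w", OF _ _ assms(2)])
      (use G_linear G_differentiable assms(1) in auto)
  show "(\<lambda>y. G y (V y) (W y)) differentiable (at x)"
    by (rule differentiableI[OF has_derivative_linear_family[OF open_S assms(1), of "\<lambda>y. G y (V y)", OF _ 1 assms(3)]])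
      (use G_linear in auto)
  show "directional (\<lambda>y. G y (V y) (W y)) x u =
      directional (\<lambda>y. G y (V x) (W x)) x u + G x (directional V x u) (W x) + G x (V x) (directional W x u)"
    using directional_linear_family[OF open_S assms(1), of "\<lambda>y. G y (V y)", OF _ 1 assms(3)]
      G_linear by (simp add: 2)
qed

lemma directional_G_nabla:
  assumes "x \<in> S" "V differentiable (at x)" "W differentiable (at x)"
  shows "directional (\<lambda>y. G y (V y) (W y)) x u = G x (nabla G V x u) (W x) + G x (V x) (nabla G W x u)"
  unfolding G_pairing_differentiable(2)[OF assms] metric_compatible[OF assms(1)] nabla_def
  by (simp add: G_simps[OF assms(1)])

end

section \<open>Killing and Sasakian fields\<close>

locale killing_chart = metric_chart +
  fixes V :: "vec7 \<Rightarrow> vec7"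
  assumes smooth_V: "smooth_on S V"
    and killing: "\<And>x u v. x \<in> S \<Longrightarrow> directional (\<lambda>y. G y u v) x (V x)
          + G x (directional V x u) v + G x u (directional V x v) = 0"
begin

lemma V_differentiable: "x \<in> S \<Longrightarrow> V differentiable (at x)"
  by (rule smooth_on_differentiable[OF smooth_V])

text \<open>This is the Killing equation in covariant form: metric compatibility along
  \<open>V\<close> replaces the derivative of the metric, and symmetry of the Christoffel symbols
  completes both partial derivatives of \<open>V\<close> to covariant ones.\<close>

lemma nabla_skew: "x \<in> S \<Longrightarrow> G x (nabla G V x u) v = - G x u (nabla G V x v)"
  using killing[of x u v] metric_compatible[of x u v "V x"] christoffel_sym[of x u "V x"]
    christoffel_sym[of x v "V x"]
  by (simp add: nabla_def G_simps)

lemma nabla_linear: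
  assumes "x \<in> S"
  shows "linear (nabla G V x)"
proof -
  have "linear (\<lambda>u. directional V x u + christoffel G x (V x) u)"
    using linear_directional[OF V_differentiable[OF assms]] christoffel_linear[OF assms]
    by (intro linear_compose_add)
  moreover have "nabla G V x = (\<lambda>u. directional V x u + christoffel G x (V x) u)"
    using christoffel_sym[OF assms, of _ "V x"] by (simp add: nabla_def fun_eq_iff)
  ultimately show ?thesis by simp
qed

text \<open>In the exterior derivative of the one-form dual to \<open>V\<close> the Christoffel
  terms cancel by symmetry, and skewness makes the two remaining terms equal.\<close>

lemma dual_form_derivative:
  assumes "x \<in> S"
  shows "directional (\<lambda>y. G y (V y) z) x u - directional (\<lambda>y. G y (V y) u) x z = 2 * G x (nabla G V x u) z"
proof -
  have *: "directional (\<lambda>y. G y (V y) w) x v = G x (nabla G V x v) w + G x (V x) (christoffel G x v w)" for v w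
    using directional_G_nabla[OF assms V_differentiable[OF assms], of "\<lambda>_. w" v]
    by (simp add: nabla_def[of _ "\<lambda>_. w"])
  show ?thesis
    unfolding * using nabla_skew[OF assms, of u z] sym_G[OF assms, of u] christoffel_sym[OF assms, of u z] by simp
qed

text \<open>The derivative of the dual form is a derivative of metric coefficients applied to
  \<open>V\<close>, plus the metric applied to a derivative of \<open>V\<close>. Both are
  differentiable again, which uses smoothness beyond first order.\<close>

lemma directional_dual_differentiable:
  assumes "x \<in> S"
  shows "(\<lambda>y. directional (\<lambda>y'. G y' (V y') z) y w) differentiable (at x)"
proof (rule directional_cong(2)[OF open_S assms])
  fix y assume y: "y \<in> S"
  show "directional (\<lambda>y'. G y' (V y) z) y w + G y (directional V y w) z
      = directional (\<lambda>y'. G y' (V y') z) y w"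
    using G_pairing_differentiable(2)[OF y V_differentiable[OF y], of "\<lambda>_. z" w] by (simp add: G_simps[OF y])
next
  have "(\<lambda>y. directional (\<lambda>y'. G y' (V y) z) y w) differentiable (at x)"
    by (rule differentiableI[OF has_derivative_linear_family[OF open_S assms,
            of "\<lambda>y v. directional (\<lambda>y'. G y' v z) y w", OF _ _ V_differentiable[OF assms]]])
      (simp_all add: linear_directional_G smooth_on_differentiable[OF smooth_on_directional[OF smooth_G] assms])
  moreover have "(\<lambda>y. G y (directional V y w) z) differentiable (at x)"
    using G_pairing_differentiable(1)[OF assms smooth_on_differentiable[OF smooth_on_directional[OF smooth_V] assms],
        of "\<lambda>_. z"] by simp
  ultimately show "(\<lambda>y. directional (\<lambda>y'. G y' (V y) z) y w + G y (directional V y w) z) differentiable (at x)"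
    by (rule differentiable_add)
qed

text \<open>The Christoffel symbols are only given implicitly, by a linear system with the Gram matrix as
  coefficients; Cramer's rule shows that its solution is differentiable.\<close>

lemma nabla_differentiable:
  assumes "x \<in> S"
  shows "(\<lambda>y. nabla G V y w) differentiable (at x)"
proof (rule differentiable_linear_solve[OF open_S assms])
  show "(\<lambda>y. gram y $ i $ j) differentiable (at x)" for i j
    unfolding gram_def using G_differentiable[OF assms] by simp
  show "det (gram y) \<noteq> 0" if "y \<in> S" for y using det_gram_nonzero[OF that] .
  show "gram y *v nabla G V y w = (\<chi> i. G y (nabla G V y w) (axis i 1))" if "y \<in> S" for y
    using gram_mult[OF that] .
  show "(\<lambda>y. (\<chi> i. G y (nabla G V y w) (axis i 1)) $ i) differentiable (at x)" for i
  proof (rule directional_cong(2)[OF open_S assms])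
    show "(\<lambda>y. (directional (\<lambda>y'. G y' (V y') (axis i 1)) y w
        - directional (\<lambda>y'. G y' (V y') w) y (axis i 1)) * (1 / 2)) differentiable (at x)"
      by (intro differentiable_mult differentiable_diff directional_dual_differentiable assms) simp
    show "(directional (\<lambda>y'. G y' (V y') (axis i 1)) y w
        - directional (\<lambda>y'. G y' (V y') w) y (axis i 1)) * (1 / 2)
        = (\<chi> i. G y (nabla G V y w) (axis i 1)) $ i" if "y \<in> S" for y
      using dual_form_derivative[OF that] by simp
  qed
qed

end

locale sasakian_chart = killing_chart +
  assumes nabla_endo_eq: "\<And>x u v. x \<in> S \<Longrightarrow>
      nabla_endo G (\<lambda>y w. - nabla G V y w) x u v = G x u v *\<^sub>R V x - G x (V x) v *\<^sub>R u"
begin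

text \<open>Differentiating an identity \<open>\<Phi> W = c U\<close> along \<open>u\<close> and inserting the Sasakian formula for \<open>\<nabla>\<Phi>\<close>.\<close>

lemma sasakian_differentiate:
  assumes "smooth_on S W" "smooth_on S U" "\<And>y. y \<in> S \<Longrightarrow> - nabla G V y (W y) = c *\<^sub>R U y" and x: "x \<in> S"
  shows "c *\<^sub>R nabla G U x u = G x u (W x) *\<^sub>R V x - G x (V x) (W x) *\<^sub>R u - nabla G V x (nabla G W x u)"
proof -
  define \<Phi> where "\<Phi> = (\<lambda>y w. - nabla G V y w)"
  have lin: "linear (\<Phi> y)" if "y \<in> S" for y
    unfolding \<Phi>_def using nabla_linear[OF that] by (rule linear_compose_neg)
  have diff: "(\<lambda>y. \<Phi> y w) differentiable (at x)" for w
    unfolding \<Phi>_def by (intro differentiable_minus nabla_differentiable x)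
  have dU: "(U has_derivative directional U x) (at x)"
    by (rule has_derivative_directional[OF smooth_on_differentiable[OF assms(2) x]])
  have "directional (\<lambda>y. \<Phi> y (W y)) x u = directional (\<lambda>y. \<Phi> y (W x)) x u + \<Phi> x (directional W x u)"
    by (rule directional_linear_family[OF open_S x lin diff smooth_on_differentiable[OF assms(1) x]])
  moreover have "directional (\<lambda>y. \<Phi> y (W y)) x u = c *\<^sub>R directional U x u"
  proof -
    have d: "((\<lambda>y. c *\<^sub>R U y) has_derivative (\<lambda>u. c *\<^sub>R directional U x u)) (at x)"
      by (rule has_derivative_scaleR_right[OF dU])
    have "directional (\<lambda>y. c *\<^sub>R U y) x = directional (\<lambda>y. \<Phi> y (W y)) x"
      by (rule directional_cong(1)[OF open_S x]) (use assms(3) \<Phi>_def differentiableI[OF d] in auto)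
    then show ?thesis using frechet_derivative_at[OF d] by metis
  qed
  moreover have "directional (\<lambda>y. \<Phi> y (W x)) x u + christoffel G x u (\<Phi> x (W x)) - \<Phi> x (christoffel G x u (W x))
      = G x u (W x) *\<^sub>R V x - G x (V x) (W x) *\<^sub>R u"
    using nabla_endo_eq[OF x, of u "W x"] unfolding nabla_endo_def \<Phi>_def .
  moreover have "\<Phi> x (W x) = c *\<^sub>R U x" using assms(3)[OF x] \<Phi>_def by simp
  ultimately have "c *\<^sub>R nabla G U x u = G x u (W x) *\<^sub>R V x - G x (V x) (W x) *\<^sub>R u + \<Phi> x (nabla G W x u)"
    using linear_scale[OF christoffel_linear[OF x, of u], of c "U x"]
    by (simp add: nabla_def linear_add[OF lin[OF x]] algebra_simps)
  then show ?thesis by (simp add: \<Phi>_def)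
qed

end

section \<open>The tangent spaces of a 3-Sasakian 7-manifold\<close>

lemma exhaust_7: "k = 1 \<or> k = 2 \<or> k = 3 \<or> k = 4 \<or> k = 5 \<or> k = 6 \<or> k = 7" for k :: 7
proof (induct k)
  case (of_int z)
  then have "z = 0 \<or> z = 1 \<or> z = 2 \<or> z = 3 \<or> z = 4 \<or> z = 5 \<or> z = 6" by auto
  then show ?case by auto
qed

lemma UNIV_7: "UNIV = {1, 2, 3, 4, 5, 6, 7 :: 7}"
  using exhaust_7 by auto

lemma sum_7: "sum f (UNIV :: 7 set) = f 1 + f 2 + f 3 + f 4 + f 5 + f 6 + f 7"
  unfolding UNIV_7 by (simp add: ac_simps)

lemma forall_7: "(\<forall>k::7. P k) \<longleftrightarrow> P 1 \<and> P 2 \<and> P 3 \<and> P 4 \<and> P 5 \<and> P 6 \<and> P 7"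
  by (metis exhaust_7)

lemma vec7_eq_iff: "(u :: real ^ 7) = v \<longleftrightarrow> u $ 1 = v $ 1 \<and> u $ 2 = v $ 2 \<and> u $ 3 = v $ 3 \<and> u $ 4 = v $ 4
    \<and> u $ 5 = v $ 5 \<and> u $ 6 = v $ 6 \<and> u $ 7 = v $ 7"
  unfolding vec_eq_iff forall_7 ..

lemma less_7_cases: "(k::nat) < 7 \<longleftrightarrow> k < 4 \<or> k = 4 \<or> k = 5 \<or> k = 6"
  by auto

lemma all_less_4: "(\<forall>a<4::nat. P a) \<longleftrightarrow> P 0 \<and> P 1 \<and> P 2 \<and> P 3"
proof -
  have "a < 4 \<longleftrightarrow> a = 0 \<or> a = 1 \<or> a = 2 \<or> a = 3" for a :: nat by arith
  then show ?thesis by auto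
qed

lemma add_3_cases: "j = i \<or> j = i + 1 \<or> j = i + 2" for i j :: 3
  using exhaust_3[of i] exhaust_3[of j] by auto

lemma add_3_simps: "(1::3) + 1 = 2" "(1::3) + 2 = 3" "(2::3) + 1 = 3" "(2::3) + 2 = 1" "(3::3) + 1 = 1" "(3::3) + 2 = 2"
  by simp_all

text \<open>Fixes one tangent space. Identities that are to be differentiated are stated at all
  points of the chart, the resulting algebra only at \<open>x\<close>.\<close>

locale three_sasakian_point =
  fixes X :: "'p topology" and \<A> :: "'p chart set" and g :: "'p bifield" and \<xi> :: "3 \<Rightarrow> 'p vfield"
    and c :: "'p chart" and x :: vec7
  assumes three_sasakian: "three_sasakian X \<A> g \<xi>"
    and c: "c \<in> \<A>" and x: "x \<in> chart_image c"
begin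

sublocale metric_chart "chart_image c" "g c"
proof -
  have "smooth_atlas X \<A>" "riemannian_metric \<A> g"
    using three_sasakian by (simp_all only: three_sasakian_def)
  then have "open (chart_image c)"
    and metric: "(\<forall>u v. smooth_on (chart_image c) (\<lambda>x. g c x u v)) \<and>
        (\<forall>x\<in>chart_image c. bilinear (g c x) \<and> (\<forall>u v. g c x u v = g c x v u) \<and>
           (\<forall>u. u \<noteq> 0 \<longrightarrow> g c x u u > 0))"
    unfolding smooth_atlas_def riemannian_metric_def using c by (blast, meson)
  then show "metric_chart (chart_image c) (g c)"
    by unfold_locales blast+
qed

sublocale sasaki: sasakian_chart "chart_image c" "g c" "\<xi> i c" for i
proof -
  have "sasakian \<A> g (\<xi> i)"
    using three_sasakian by (simp only: three_sasakian_def)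
  note * = this[unfolded sasakian_def killing_field_def]
  have "smooth_on (chart_image c) (\<xi> i c)"
    using conjunct1[OF conjunct1[OF *]] c unfolding vector_field_def by blast
  then show "sasakian_chart (chart_image c) (g c) (\<xi> i c)"
    using conjunct2[OF conjunct1[OF *]] conjunct2[OF *] c by unfold_locales blast+
qed

section \<open>Quaternionic relations between the endomorphisms \<Phi>_i\<close>

abbreviation B :: "vec7 \<Rightarrow> vec7 \<Rightarrow> real" where "B \<equiv> g c x"
abbreviation Z :: "3 \<Rightarrow> vec7" where "Z i \<equiv> \<xi> i c x"

definition \<Phi> :: "3 \<Rightarrow> vec7 \<Rightarrow> vec7" where "\<Phi> i u = - nabla (g c) (\<xi> i c) x u"

lemmas B_simps = G_simps[OF x]
lemmas B_sym = sym_G[OF x]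

lemma Z_orthonormal_at: "y \<in> chart_image c \<Longrightarrow> g c y (\<xi> i c y) (\<xi> j c y) = (if i = j then 1 else 0)"
  using three_sasakian c unfolding three_sasakian_def by blast

lemma Z_orthonormal: "B (Z i) (Z j) = (if i = j then 1 else 0)"
  using Z_orthonormal_at[OF x] .

lemma \<Phi>_linear: "linear (\<Phi> i)"
  unfolding \<Phi>_def using sasaki.nabla_linear[OF x] by (rule linear_compose_neg)

lemma \<Phi>_simps:
  "\<Phi> i (u + v) = \<Phi> i u + \<Phi> i v" "\<Phi> i (u - v) = \<Phi> i u - \<Phi> i v" "\<Phi> i (- u) = - \<Phi> i u"
  "\<Phi> i (r *\<^sub>R u) = r *\<^sub>R \<Phi> i u" "\<Phi> i 0 = 0"
  using \<Phi>_linear[of i] by (simp_all add: linear_add linear_diff linear_neg linear_scale linear_0)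

lemma \<Phi>_skew: "B (\<Phi> i u) v = - B u (\<Phi> i v)"
  unfolding \<Phi>_def using sasaki.nabla_skew[OF x, of i u v] by (simp add: B_simps)

text \<open>Differentiating the constant inner product of two of the fields relates their covariant
  derivatives; skewness of both then moves the direction of differentiation into the other
  slot.\<close>

lemma nabla_Z_sym:
  assumes y: "y \<in> chart_image c"
  shows "nabla (g c) (\<xi> i c) y (\<xi> j c y) = - nabla (g c) (\<xi> j c) y (\<xi> i c y)"
proof (rule G_eqI[OF y])
  fix u
  have "((\<lambda>y. g c y (\<xi> i c y) (\<xi> j c y)) has_derivative (\<lambda>u. 0)) (at y)"
    by (rule has_derivative_transform_within_open[OF has_derivative_const open_S y, of "if i = j then 1 else 0"])
      (simp add: Z_orthonormal_at)
  then have "directional (\<lambda>y. g c y (\<xi> i c y) (\<xi> j c y)) y u = 0"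
    by (metis frechet_derivative_at)
  then have "g c y (nabla (g c) (\<xi> i c) y u) (\<xi> j c y) + g c y (\<xi> i c y) (nabla (g c) (\<xi> j c) y u) = 0"
    using directional_G_nabla[OF y sasaki.V_differentiable[OF y, of i] sasaki.V_differentiable[OF y, of j]] by simp
  then show "g c y (nabla (g c) (\<xi> i c) y (\<xi> j c y)) u = g c y (- nabla (g c) (\<xi> j c) y (\<xi> i c y)) u"
    using sasaki.nabla_skew[OF y, of i u "\<xi> j c y"] sasaki.nabla_skew[OF y, of j u "\<xi> i c y"]
      sym_G[OF y, of u] sym_G[OF y, of "\<xi> i c y" "nabla (g c) (\<xi> j c) y u"] by (simp add: G_simps[OF y])
qed

lemma nabla_Z_self: "y \<in> chart_image c \<Longrightarrow> nabla (g c) (\<xi> i c) y (\<xi> i c y) = 0"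
  using nabla_Z_sym[of y i i] by (simp add: eq_neg_iff_add_eq_0 flip: scaleR_2)

text \<open>The bracket is the difference of two covariant derivatives, since the Christoffel terms
  are symmetric. These are opposite by \<open>nabla_Z_sym\<close>, so the 2 of the bracket relation
  cancels.\<close>

lemma nabla_Z_next:
  assumes y: "y \<in> chart_image c"
  shows "nabla (g c) (\<xi> i c) y (\<xi> (i + 1) c y) = - \<xi> (i + 2) c y"
proof -
  have "lie_bracket (\<xi> i c) (\<xi> (i + 1) c) y = 2 *\<^sub>R \<xi> (i + 2) c y"
    using three_sasakian c y unfolding three_sasakian_def by blast
  moreover have "lie_bracket (\<xi> i c) (\<xi> (i + 1) c) y
      = nabla (g c) (\<xi> (i + 1) c) y (\<xi> i c y) - nabla (g c) (\<xi> i c) y (\<xi> (i + 1) c y)"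
    unfolding lie_bracket_def nabla_def
    using christoffel_sym[OF y, of "\<xi> i c y" "\<xi> (i + 1) c y"] by simp
  ultimately have "2 *\<^sub>R \<xi> (i + 2) c y = - (2 *\<^sub>R nabla (g c) (\<xi> i c) y (\<xi> (i + 1) c y))"
    using nabla_Z_sym[OF y, of "i + 1" i] by (simp add: scaleR_2)
  then have "2 *\<^sub>R (\<xi> (i + 2) c y + nabla (g c) (\<xi> i c) y (\<xi> (i + 1) c y)) = 0"
    unfolding scaleR_add_right by simp
  then have "\<xi> (i + 2) c y + nabla (g c) (\<xi> i c) y (\<xi> (i + 1) c y) = 0"
    unfolding scaleR_eq_0_iff by simp
  then show ?thesis by (simp add: add_eq_0_iff)
qed

lemma \<Phi>_Z: "\<Phi> i (Z i) = 0" "\<Phi> i (Z (i + 1)) = Z (i + 2)" "\<Phi> (i + 1) (Z i) = - Z (i + 2)"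
  unfolding \<Phi>_def using nabla_Z_self[OF x] nabla_Z_next[OF x] nabla_Z_sym[OF x, of "i + 1" i] by simp_all

lemma \<Phi>_square: "\<Phi> i (\<Phi> i u) = B (Z i) u *\<^sub>R Z i - u"
proof -
  \<comment> \<open>The identity \<Phi>_i \<xi>_i = 0 enters with \<open>c = 0\<close>, so the field
    on its right-hand side is a placeholder.\<close>
  have "0 *\<^sub>R nabla (g c) (\<xi> i c) x u = g c x u (Z i) *\<^sub>R Z i - g c x (Z i) (Z i) *\<^sub>R u
      - nabla (g c) (\<xi> i c) x (nabla (g c) (\<xi> i c) x u)"
    by (rule sasaki.sasakian_differentiate[OF sasaki.smooth_V sasaki.smooth_V _ x]) (simp add: nabla_Z_self)
  then show ?thesis
    using linear_neg[OF sasaki.nabla_linear[OF x]] by (simp add: \<Phi>_def Z_orthonormal B_sym[of u])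
qed

lemma \<Phi>_compose: "\<Phi> i (\<Phi> (i + 1) u) = \<Phi> (i + 2) u + B (Z (i + 1)) u *\<^sub>R Z i"
proof -
  \<comment> \<open>Here the differentiated identity is \<Phi>_i \<xi>_(i+1) = \<xi>_(i+2). The
    result holds for all vectors; its last term disappears on horizontal ones.\<close>
  have "1 *\<^sub>R nabla (g c) (\<xi> (i + 2) c) x u = g c x u (Z (i + 1)) *\<^sub>R Z i - g c x (Z i) (Z (i + 1)) *\<^sub>R u
      - nabla (g c) (\<xi> i c) x (nabla (g c) (\<xi> (i + 1) c) x u)"
    by (rule sasaki.sasakian_differentiate[OF sasaki.smooth_V sasaki.smooth_V _ x]) (simp add: nabla_Z_next)
  then show ?thesis
    using linear_neg[OF sasaki.nabla_linear[OF x]] by (simp add: \<Phi>_def Z_orthonormal B_sym[of u])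
qed

section \<open>The forms \<eta>_i and \<omega>_i at a point\<close>

lemma eta_eq: "eta g \<xi> i c = (\<lambda>y. one_form (\<lambda>v. g c y (\<xi> i c y) v))"
  by (rule ext) (simp add: eta_def)

lemma ext_d_eta: "ext_d (eta g \<xi> i c) x [u, v] = - 2 * B (\<Phi> i u) v"
  using sasaki.dual_form_derivative[OF x, of i v u]
  by (simp add: ext_d_def eta_eq \<Phi>_def B_simps numeral_2_eq_2)

text \<open>Deleting one entry leaves a single vector only from a list of length 2, and
  \<open>one_form\<close> vanishes on all other lists.\<close>

lemma ext_d_eta_degree: "length vs \<noteq> 2 \<Longrightarrow> ext_d (eta g \<xi> i c) x vs = 0"
proof -
  assume len: "length vs \<noteq> 2"
  have "one_form (f y) (take k vs @ drop (Suc k) vs) = 0" if "k < length vs" for k and f :: "vec7 \<Rightarrow> vec7 \<Rightarrow> real" and y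
  proof -
    have "take k vs @ drop (Suc k) vs \<noteq> [w]" for w
    proof
      assume "take k vs @ drop (Suc k) vs = [w]"
      from arg_cong[OF this, of length] show False using len that by simp
    qed
    then show ?thesis by (auto simp: one_form_def split: list.split)
  qed
  then show ?thesis by (simp add: ext_d_def eta_eq)
qed

lemma omega_degree: "length vs \<noteq> 2 \<Longrightarrow> omega g \<xi> i c x vs = 0"
  by (simp add: omega_def ext_d_eta_degree) (simp add: eta_eq wedge_one_form_degree)

lemma omega_eq: "omega g \<xi> i c x [u, v] = B (\<Phi> i u) v
    - (B (Z (i + 1)) u * B (Z (i + 2)) v - B (Z (i + 2)) u * B (Z (i + 1)) v)"
  by (simp add: omega_def ext_d_eta) (simp add: eta_eq wedge_one_form_one_form_Cons field_simps)

section \<open>Orthonormal frames with three vertical members\<close>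

definition frame :: "(nat \<Rightarrow> vec7) \<Rightarrow> nat \<Rightarrow> vec7" where
  "frame e k = (if k < 4 then e k else if k = 4 then Z 1 else if k = 5 then Z 2 else Z 3)"

abbreviation coframe :: "(nat \<Rightarrow> vec7) \<Rightarrow> nat \<Rightarrow> vec7 \<Rightarrow> real" where
  "coframe e k v \<equiv> B (frame e k) v"

definition horizontal_frame :: "(nat \<Rightarrow> vec7) \<Rightarrow> bool" where
  "horizontal_frame e \<longleftrightarrow> (\<forall>a<4. \<forall>i. B (Z i) (e a) = 0)
     \<and> (\<forall>a<4. \<forall>b<4. B (e a) (e b) = (if a = b then 1 else 0))"

lemma frame_simps [simp]: "k < 4 \<Longrightarrow> frame e k = e k" "frame e 4 = Z 1" "frame e 5 = Z 2" "frame e 6 = Z 3"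
  by (simp_all add: frame_def)

lemma frame_dual:
  assumes "horizontal_frame e" "k < 7" "l < 7"
  shows "B (frame e k) (frame e l) = (if k = l then 1 else 0)"
proof -
  have "B (Z i) (e a) = 0" "B (e a) (Z i) = 0" if "a < 4" for a i
    using assms(1) that B_sym[of "e a" "Z i"] unfolding horizontal_frame_def by simp_all
  moreover have "B (e a) (e b) = (if a = b then 1 else 0)" if "a < 4" "b < 4" for a b
    using assms(1) that unfolding horizontal_frame_def by simp
  ultimately show ?thesis
    using assms(2,3) unfolding less_7_cases by (auto simp: Z_orthonormal)
qed

lemma g2_coordinates_linear: "linear (g2_coordinates t \<epsilon> (coframe e))"
  by (rule linearI) (simp_all add: vec7_eq_iff g2_coordinates_nth B_simps algebra_simps)

text \<open>Duality makes \<open>K\<close> a right inverse of the coordinate map; between spaces of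
  equal dimension it is then also a left inverse, so no separate spanning argument is
  required.\<close>

lemma frame_expansion:
  assumes "horizontal_frame e"
  shows "u = coframe e 0 u *\<^sub>R e 0 + coframe e 1 u *\<^sub>R e 1 + coframe e 2 u *\<^sub>R e 2 + coframe e 3 u *\<^sub>R e 3
    + B (Z 1) u *\<^sub>R Z 1 + B (Z 2) u *\<^sub>R Z 2 + B (Z 3) u *\<^sub>R Z 3"
proof -
  \<comment> \<open>The order of the terms and the two minus signs undo those of
    \<open>g2_coordinates\<close> with both parameters 1.\<close>
  define K :: "vec7 \<Rightarrow> vec7" where "K = (\<lambda>c. c $ 1 *\<^sub>R frame e 4 + c $ 2 *\<^sub>R frame e 5 + c $ 3 *\<^sub>R frame e 6
      + c $ 4 *\<^sub>R frame e 0 - c $ 5 *\<^sub>R frame e 1 - c $ 6 *\<^sub>R frame e 2 + c $ 7 *\<^sub>R frame e 3)"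
  let ?L = "g2_coordinates 1 1 (coframe e)"
  have "linear K"
    unfolding K_def by (rule linearI) (simp_all add: algebra_simps)
  moreover have "?L \<circ> K = id"
    unfolding K_def
    by (simp add: fun_eq_iff vec7_eq_iff g2_coordinates_nth B_simps frame_dual[OF assms] del: frame_simps)
  ultimately have "K \<circ> ?L = id"
    using linear_inverse_left[OF g2_coordinates_linear] by blast
  from fun_cong[OF this, of u] have "K (?L u) = u" by simp
  then show ?thesis by (simp add: K_def g2_coordinates_nth algebra_simps)
qed

lemma parseval:
  assumes "horizontal_frame e"
  shows "B u v = coframe e 0 u * coframe e 0 v + coframe e 1 u * coframe e 1 v
    + coframe e 2 u * coframe e 2 v + coframe e 3 u * coframe e 3 v
    + B (Z 1) u * B (Z 1) v + B (Z 2) u * B (Z 2) v + B (Z 3) u * B (Z 3) v"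
  by (subst frame_expansion[OF assms, of u]) (simp add: B_simps)

lemma g2_coordinates_bij:
  assumes "horizontal_frame e" "t \<noteq> 0" "\<epsilon> \<noteq> 0"
  shows "bij (g2_coordinates t \<epsilon> (coframe e))"
proof -
  have "inj (g2_coordinates t \<epsilon> (coframe e))"
  proof (rule injI)
    fix u v assume "g2_coordinates t \<epsilon> (coframe e) u = g2_coordinates t \<epsilon> (coframe e) v"
    then have "coframe e 0 u = coframe e 0 v" "coframe e 1 u = coframe e 1 v" "coframe e 2 u = coframe e 2 v"
      "coframe e 3 u = coframe e 3 v" "B (Z 1) u = B (Z 1) v" "B (Z 2) u = B (Z 2) v" "B (Z 3) u = B (Z 3) v"
      using assms(2,3) unfolding vec7_eq_iff g2_coordinates_nth by simp_all
    then show "u = v"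
      using frame_expansion[OF assms(1), of u] frame_expansion[OF assms(1), of v] by simp
  qed
  then show ?thesis
    using linear_injective_imp_surjective[OF g2_coordinates_linear] by (simp add: bij_def)
qed

section \<open>Horizontality and self-duality of the \<omega>_i\<close>

lemma omega_simps:
  "omega g \<xi> i c x [u + u', v] = omega g \<xi> i c x [u, v] + omega g \<xi> i c x [u', v]"
  "omega g \<xi> i c x [u, v + v'] = omega g \<xi> i c x [u, v] + omega g \<xi> i c x [u, v']"
  "omega g \<xi> i c x [r *\<^sub>R u, v] = r * omega g \<xi> i c x [u, v]"
  "omega g \<xi> i c x [u, r *\<^sub>R v] = r * omega g \<xi> i c x [u, v]"
  "omega g \<xi> i c x [- u, v] = - omega g \<xi> i c x [u, v]"
  "omega g \<xi> i c x [u, - v] = - omega g \<xi> i c x [u, v]"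
  by (simp_all add: omega_eq \<Phi>_simps B_simps algebra_simps)

lemma omega_skew: "omega g \<xi> i c x [u, v] = - omega g \<xi> i c x [v, u]"
  using \<Phi>_skew[of i u v] B_sym[of u] by (simp add: omega_eq)

text \<open>On \<open>Z (i + 1)\<close> and \<open>Z (i + 2)\<close> the subtracted term
  \<eta>_(i+1) \<and> \<eta>_(i+2) cancels the contribution of \<Phi>_i, and \<open>Z i\<close> is
  annihilated by both.\<close>

lemma omega_vertical: "omega g \<xi> i c x [Z j, v] = 0" "omega g \<xi> i c x [v, Z j] = 0"
proof -
  have *: "i + 2 + 1 = i" "i + 2 + 2 = i + 1" by simp_all
  have "\<Phi> i (Z (i + 2)) = - Z (i + 1)"
    using \<Phi>_Z(3)[of "i + 2"] by (simp only: *)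
  then show "omega g \<xi> i c x [Z j, v] = 0" for v
    using add_3_cases[of j i] by (auto simp: omega_eq \<Phi>_Z Z_orthonormal B_simps)
  then show "omega g \<xi> i c x [v, Z j] = 0" using omega_skew[of i v "Z j"] by simp
qed

text \<open>Expanding both arguments in the frame, vertical vectors drop out and the orientation
  condition leaves three coefficients. An arbitrary oriented frame is allowed, since the definition
  of the volume form ranges over all of them.\<close>

lemma omega_self_dual:
  assumes "oriented_horizontal_frame g \<xi> c x e"
  shows "omega g \<xi> i c x = self_dual (\<lambda>k. one_form (coframe e k))
    (omega g \<xi> i c x [e 0, e 1]) (omega g \<xi> i c x [e 0, e 2]) (omega g \<xi> i c x [e 0, e 3])"
proof
  have e: "horizontal_frame e"
    using assms by (simp add: oriented_horizontal_frame_def horizontal_frame_def eta_eq)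
  fix vs :: "vec7 list"
  show "omega g \<xi> i c x vs = self_dual (\<lambda>k. one_form (coframe e k))
    (omega g \<xi> i c x [e 0, e 1]) (omega g \<xi> i c x [e 0, e 2]) (omega g \<xi> i c x [e 0, e 3]) vs"
  proof (cases "length vs = 2")
    case True
    then obtain u v where vs: "vs = [u, v]"
      by (auto simp: numeral_2_eq_2 length_Suc_conv)
    have diag: "omega g \<xi> i c x [w, w] = 0" for w using omega_skew[of i w w] by simp
    have sd: "omega g \<xi> i c x [e 2, e 3] = omega g \<xi> i c x [e 0, e 1]"
      "omega g \<xi> i c x [e 3, e 1] = omega g \<xi> i c x [e 0, e 2]"
      "omega g \<xi> i c x [e 1, e 2] = omega g \<xi> i c x [e 0, e 3]"
      using assms unfolding oriented_horizontal_frame_def by simp_all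
    have skew: "omega g \<xi> i c x [e 3, e 2] = - omega g \<xi> i c x [e 0, e 1]"
      "omega g \<xi> i c x [e 1, e 3] = - omega g \<xi> i c x [e 0, e 2]"
      "omega g \<xi> i c x [e 2, e 1] = - omega g \<xi> i c x [e 0, e 3]"
      "omega g \<xi> i c x [e 1, e 0] = - omega g \<xi> i c x [e 0, e 1]"
      "omega g \<xi> i c x [e 2, e 0] = - omega g \<xi> i c x [e 0, e 2]"
      "omega g \<xi> i c x [e 3, e 0] = - omega g \<xi> i c x [e 0, e 3]"
      using omega_skew[of i "e 3" "e 2"] omega_skew[of i "e 1" "e 3"] omega_skew[of i "e 2" "e 1"]
        omega_skew[of i "e 1" "e 0"]
        omega_skew[of i "e 2" "e 0"] omega_skew[of i "e 3" "e 0"] sd by simp_all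
    show ?thesis
      unfolding vs
      by (subst frame_expansion[OF e, of u], subst frame_expansion[OF e, of v])
        (simp add: omega_simps omega_vertical diag sd[unfolded One_nat_def] skew[unfolded One_nat_def]
          self_dual_def wedge_one_form_one_form_Cons algebra_simps)
  qed (simp add: omega_degree self_dual_degree)
qed

text \<open>The three coefficients are the components of \<Phi>_i e_0, a unit vector that is
  horizontal and orthogonal to e_0, so \<open>parseval\<close> applies.\<close>

lemma omega_norm:
  assumes "oriented_horizontal_frame g \<xi> c x e"
  shows "(omega g \<xi> i c x [e 0, e 1])\<^sup>2 + (omega g \<xi> i c x [e 0, e 2])\<^sup>2 + (omega g \<xi> i c x [e 0, e 3])\<^sup>2 = 1"
proof -
  have e: "horizontal_frame e"
    using assms by (simp add: oriented_horizontal_frame_def horizontal_frame_def eta_eq)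
  have e0: "B (Z j) (e 0) = 0" "B (e 0) (e 0) = 1" for j using e by (simp_all add: horizontal_frame_def)
  have om: "omega g \<xi> i c x [e 0, v] = B v (\<Phi> i (e 0))" for v
    by (simp add: omega_eq e0 B_sym[of v])
  have "B (\<Phi> i (e 0)) (\<Phi> i (e 0)) = 1"
    by (simp add: \<Phi>_skew \<Phi>_square e0 B_simps)
  moreover have "B (Z j) (\<Phi> i (e 0)) = 0" for j
    using om[of "Z j"] omega_vertical(2)[of i "e 0" j] by simp
  moreover have "B (e 0) (\<Phi> i (e 0)) = 0"
    using \<Phi>_skew[of i "e 0" "e 0"] B_sym[of "e 0" "\<Phi> i (e 0)"] by simp
  ultimately show ?thesis
    using parseval[OF e, of "\<Phi> i (e 0)" "\<Phi> i (e 0)"] by (simp add: om power2_eq_square)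
qed

text \<open>The volume form does not depend on the oriented frame because it is \<open>1/2 \<omega>\<^sub>1 \<and> \<omega>\<^sub>1\<close>.\<close>

lemma pull_volZ_eq:
  assumes "oriented_horizontal_frame g \<xi> c x e"
  shows "pull_volZ g \<xi> c x = wedge_list (map (\<lambda>k. one_form (coframe e k)) [0, 1, 2, 3])"
proof -
  have *: "(omega g \<xi> 1 c x \<and>\<^sub>\<Lambda> omega g \<xi> 1 c x) = 2 \<cdot>\<^sub>\<Lambda> wedge_list (map (\<lambda>k. one_form (coframe e k)) [0, 1, 2, 3])"
    if "oriented_horizontal_frame g \<xi> c x e" for e
    using arg_cong2[where f = wedge, OF omega_self_dual[OF that, of 1] omega_self_dual[OF that, of 1]]
    unfolding self_dual_square omega_norm[OF that] by simp
  have "pull_volZ g \<xi> c x = (THE \<nu>. \<exists>e. oriented_horizontal_frame g \<xi> c x e \<and>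
      \<nu> = wedge_list (map (\<lambda>k. one_form (coframe e k)) [0, 1, 2, 3]))"
    by (simp add: pull_volZ_def)
  also have "\<dots> = wedge_list (map (\<lambda>k. one_form (coframe e k)) [0, 1, 2, 3])"
  proof (rule the_equality)
    fix \<nu> assume "\<exists>e. oriented_horizontal_frame g \<xi> c x e \<and> \<nu> = wedge_list (map (\<lambda>k. one_form (coframe e k)) [0, 1, 2, 3])"
    then obtain e' where e': "oriented_horizontal_frame g \<xi> c x e'"
      and \<nu>: "\<nu> = wedge_list (map (\<lambda>k. one_form (coframe e' k)) [0, 1, 2, 3])" by blast
    have "2 \<cdot>\<^sub>\<Lambda> \<nu> = 2 \<cdot>\<^sub>\<Lambda> wedge_list (map (\<lambda>k. one_form (coframe e k)) [0, 1, 2, 3])"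
      unfolding \<nu> *[OF e', symmetric] *[OF assms, symmetric] ..
    then show "\<nu> = wedge_list (map (\<lambda>k. one_form (coframe e k)) [0, 1, 2, 3])"
      by (simp only: scale_form_def fun_eq_iff) simp
  qed (use assms in blast)
  finally show ?thesis .
qed

section \<open>Existence of adapted frames\<close>

definition adapted_frame :: "(nat \<Rightarrow> vec7) \<Rightarrow> bool" where
  "adapted_frame e \<longleftrightarrow> oriented_horizontal_frame g \<xi> c x e
     \<and> omega g \<xi> 1 c x = self_dual (\<lambda>k. one_form (coframe e k)) 1 0 0
     \<and> omega g \<xi> 2 c x = self_dual (\<lambda>k. one_form (coframe e k)) 0 1 0
     \<and> omega g \<xi> 3 c x = self_dual (\<lambda>k. one_form (coframe e k)) 0 0 1"

lemma adapted_frame_horizontal: "adapted_frame e \<Longrightarrow> horizontal_frame e"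
  by (simp add: adapted_frame_def oriented_horizontal_frame_def horizontal_frame_def eta_eq)

text \<open>The three conditions are padded with zeros to an endomorphism of the seven-dimensional
  space. It misses \<open>axis 7 1\<close>, so it is not surjective and hence has a kernel; a kernel
  vector is then normalised.\<close>

lemma unit_horizontal_vector: "\<exists>u. (\<forall>i. B (Z i) u = 0) \<and> B u u = 1"
proof -
  define f :: "vec7 \<Rightarrow> vec7" where "f = (\<lambda>u. vector [B (Z 1) u, B (Z 2) u, B (Z 3) u])"
  have nth: "f u $ 1 = B (Z 1) u" "f u $ 2 = B (Z 2) u" "f u $ 3 = B (Z 3) u" "f u $ 4 = 0"
    "f u $ 5 = 0" "f u $ 6 = 0" "f u $ 7 = 0" for u
    by (simp_all add: f_def vector_def)
  have lin: "linear f"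
    by (rule linearI) (simp_all add: vec7_eq_iff nth B_simps)
  have "\<not> surj f"
  proof
    assume "surj f"
    then obtain u where "axis 7 1 = f u" by (rule surjE)
    then show False using nth(7)[of u] by (metis axis_nth zero_neq_one)
  qed
  then have "\<not> inj f" using linear_injective_imp_surjective[OF lin] by argo
  then obtain w where w: "w \<noteq> 0" "f w = 0" unfolding linear_injective_0[OF lin] by auto
  have pos: "B w w > 0" using pos_G[OF x w(1)] .
  have "B (Z 1) w = 0" "B (Z 2) w = 0" "B (Z 3) w = 0"
    using nth(1-3)[of w] unfolding w(2) by simp_all
  then have "B (Z i) w = 0" for i using exhaust_3[of i] by auto
  then have "(\<forall>i. B (Z i) ((1 / sqrt (B w w)) *\<^sub>R w) = 0) \<and> B ((1 / sqrt (B w w)) *\<^sub>R w) ((1 / sqrt (B w w)) *\<^sub>R w) = 1"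
    using pos by (simp add: B_simps field_simps)
  then show ?thesis by blast
qed

lemma adapted_frame_exists: "\<exists>e. adapted_frame e"
proof -
  obtain e0 where e0: "\<And>i. B (Z i) e0 = 0" "B e0 e0 = 1"
    using unit_horizontal_vector by blast
  define e where "e = (\<lambda>k::nat. if k = 0 then e0 else if k = 1 then \<Phi> 1 e0 else if k = 2 then \<Phi> 2 e0 else \<Phi> 3 e0)"
  have horizontal: "B (Z j) (\<Phi> i u) = 0" if "\<And>k. B (Z k) u = 0" for i j u
    using omega_vertical(2)[of i u j] that by (simp add: omega_eq B_sym[of "Z j"])
  have square: "\<Phi> i (\<Phi> i u) = - u" if "\<And>k. B (Z k) u = 0" for i u
    using that by (simp add: \<Phi>_square)
  have compose: "\<Phi> i (\<Phi> (i + 1) u) = \<Phi> (i + 2) u" if "\<And>k. B (Z k) u = 0" for i u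
    using that by (simp add: \<Phi>_compose)
  have cyc: "\<Phi> 1 (\<Phi> 2 e0) = \<Phi> 3 e0" "\<Phi> 2 (\<Phi> 3 e0) = \<Phi> 1 e0" "\<Phi> 3 (\<Phi> 1 e0) = \<Phi> 2 e0"
    using compose[of e0 1] compose[of e0 2] compose[of e0 3] e0(1) by (simp_all only: add_3_simps)
  \<comment> \<open>The reversed products follow by applying \<Phi>_i to \<Phi>_i \<Phi>_j =
    \<Phi>_k and using that \<Phi>_i squares to -1 on horizontal vectors.\<close>
  have "\<Phi> 2 (\<Phi> 2 (\<Phi> 3 e0)) = - \<Phi> 3 e0" "\<Phi> 3 (\<Phi> 3 (\<Phi> 1 e0)) = - \<Phi> 1 e0" "\<Phi> 1 (\<Phi> 1 (\<Phi> 2 e0)) = - \<Phi> 2 e0"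
    by (simp_all add: square horizontal e0)
  then have acyc: "\<Phi> 2 (\<Phi> 1 e0) = - \<Phi> 3 e0" "\<Phi> 3 (\<Phi> 2 e0) = - \<Phi> 1 e0" "\<Phi> 1 (\<Phi> 3 e0) = - \<Phi> 2 e0"
    by (simp_all only: cyc)
  have sq: "\<Phi> i (\<Phi> i e0) = - e0" for i using square e0 by simp
  have self: "B e0 (\<Phi> i e0) = 0" "B (\<Phi> i e0) e0 = 0" for i
    using \<Phi>_skew[of i e0 e0] B_sym[of e0 "\<Phi> i e0"] by simp_all
  have prod: "B (\<Phi> i e0) (\<Phi> j e0) = - B e0 (\<Phi> i (\<Phi> j e0))" for i j by (rule \<Phi>_skew)
  have gram: "B (\<Phi> 1 e0) (\<Phi> 1 e0) = 1" "B (\<Phi> 2 e0) (\<Phi> 2 e0) = 1" "B (\<Phi> 3 e0) (\<Phi> 3 e0) = 1"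
    "B (\<Phi> 1 e0) (\<Phi> 2 e0) = 0" "B (\<Phi> 2 e0) (\<Phi> 1 e0) = 0" "B (\<Phi> 1 e0) (\<Phi> 3 e0) = 0"
    "B (\<Phi> 3 e0) (\<Phi> 1 e0) = 0" "B (\<Phi> 2 e0) (\<Phi> 3 e0) = 0" "B (\<Phi> 3 e0) (\<Phi> 2 e0) = 0"
    unfolding prod by (simp_all add: cyc acyc sq self e0 B_simps)
  have om0: "omega g \<xi> i c x [e0, v] = B (\<Phi> i e0) v" for i v
    by (simp add: omega_eq e0)
  have om: "omega g \<xi> i c x [\<Phi> j e0, v] = B (\<Phi> i (\<Phi> j e0)) v" for i j v
    by (simp add: omega_eq e0 horizontal)
  have e: "e 0 = e0" "e 1 = \<Phi> 1 e0" "e 2 = \<Phi> 2 e0" "e 3 = \<Phi> 3 e0" by (simp_all add: e_def)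
  have "oriented_horizontal_frame g \<xi> c x e"
    unfolding oriented_horizontal_frame_def all_less_4 e forall_3 om0 om cyc acyc sq eta_eq
    by (simp add: horizontal e0 self gram B_simps)
  \<comment> \<open>The self-dual coefficients of \<omega>_i are the inner products of \<Phi>_i e_0
    with the \<Phi>_j e_0, thus 1 for j = i and 0 otherwise.\<close>
  moreover note omega_self_dual[OF this, unfolded e om0]
  from this[of 1] this[of 2] this[of 3]
  have "omega g \<xi> 1 c x = self_dual (\<lambda>k. one_form (coframe e k)) 1 0 0"
    "omega g \<xi> 2 c x = self_dual (\<lambda>k. one_form (coframe e k)) 0 1 0"
    "omega g \<xi> 3 c x = self_dual (\<lambda>k. one_form (coframe e k)) 0 0 1"
    unfolding gram .
  ultimately show ?thesis unfolding adapted_frame_def by blast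
qed

section \<open>The G2-structures in an adapted frame\<close>

lemma eta_coframe:
  "eta g \<xi> 1 c x = one_form (coframe e 4)" "eta g \<xi> 2 c x = one_form (coframe e 5)"
  "eta g \<xi> 3 c x = one_form (coframe e 6)"
  by (simp_all add: eta_eq)

lemma phi_eq:
  assumes "adapted_frame e"
  shows "phi t \<epsilon> g \<xi> c x vs = standard_phi (map (g2_coordinates t \<epsilon> (coframe e)) vs)"
  using assms unfolding adapted_frame_def standard_phi_g2_coordinates phi_def Let_def
  by (simp only: eta_coframe[of e])

lemma psi_eq:
  assumes "adapted_frame e"
  shows "psi t \<epsilon> g \<xi> c x vs = standard_psi (map (g2_coordinates t \<epsilon> (coframe e)) vs)"
  using assms pull_volZ_eq[of e] unfolding adapted_frame_def standard_psi_g2_coordinates psi_def Let_def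
  by (simp only: eta_coframe[of e])

lemma eta_single: "eta g \<xi> i c x [u] = B (Z i) u"
  by (simp add: eta_eq)

lemma canonical_metric_eq:
  assumes "adapted_frame e"
  shows "canonical_metric t g \<xi> c x u v = t\<^sup>2 * (B (Z 1) u * B (Z 1) v + B (Z 2) u * B (Z 2) v + B (Z 3) u * B (Z 3) v)
    + coframe e 0 u * coframe e 0 v + coframe e 1 u * coframe e 1 v
    + coframe e 2 u * coframe e 2 v + coframe e 3 u * coframe e 3 v"
proof -
  have e: "horizontal_frame e" using assms by (rule adapted_frame_horizontal)
  have "B (e a) (Z i) = 0" if "a < 4" for a i
    using e that B_sym[of "e a" "Z i"] by (simp add: horizontal_frame_def)
  then have "coframe e a (horizontal_part g \<xi> c x u) = coframe e a u" if "a < 4" for a u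
    using that by (simp add: horizontal_part_def eta_single sum_3 B_simps)
  moreover have "B (Z i) (horizontal_part g \<xi> c x u) = 0" for i u
    using exhaust_3[of i] by (auto simp: horizontal_part_def eta_single sum_3 B_simps Z_orthonormal)
  ultimately show ?thesis
    unfolding canonical_metric_def pull_gZ_def
    by (subst parseval[OF e]) (simp add: eta_single sum_3)
qed

lemma canonical_metric_1: "canonical_metric 1 g \<xi> c x u v = B u v"
proof -
  obtain e where e: "adapted_frame e" using adapted_frame_exists ..
  show ?thesis
    unfolding canonical_metric_eq[OF e] by (subst parseval[OF adapted_frame_horizontal[OF e], of u v]) simp
qed

lemma g2_identification:
  assumes "t \<noteq> 0" "\<epsilon> \<in> {1, -1}"
  shows "\<exists>L. linear L \<and> bij L \<and> (\<forall>vs. phi t \<epsilon> g \<xi> c x vs = standard_phi (map L vs)) \<and>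
        (\<forall>u v. canonical_metric t g \<xi> c x u v = L u \<bullet> L v) \<and>
        (\<forall>vs. psi t \<epsilon> g \<xi> c x vs = standard_psi (map L vs))"
proof -
  obtain e where e: "adapted_frame e" using adapted_frame_exists ..
  \<comment> \<open>The third coordinate carries the factor \<epsilon>, whose square is 1, so the
    metric does not see the sign.\<close>
  have "canonical_metric t g \<xi> c x u v = g2_coordinates t \<epsilon> (coframe e) u \<bullet> g2_coordinates t \<epsilon> (coframe e) v" for u v
    unfolding canonical_metric_eq[OF e] inner_vec_def sum_7 g2_coordinates_nth
    using assms(2) by (auto simp: algebra_simps power2_eq_square)
  moreover have "bij (g2_coordinates t \<epsilon> (coframe e))"
    using g2_coordinates_bij[OF adapted_frame_horizontal[OF e] assms(1)] assms(2) by auto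
  ultimately show ?thesis
    using g2_coordinates_linear phi_eq[OF e] psi_eq[OF e] by blast
qed

section \<open>The instanton equation\<close>

lemma ext_d_eta_form:
  "ext_d (eta g \<xi> i c) x = - 2 \<cdot>\<^sub>\<Lambda> (omega g \<xi> i c x + eta g \<xi> (i + 1) c x \<and>\<^sub>\<Lambda> eta g \<xi> (i + 2) c x)"
proof
  fix vs
  have "d = - 2 * (- (1 / 2) * (d + 2 * w) + w)" for d w :: real by (simp add: algebra_simps)
  then show "ext_d (eta g \<xi> i c) x vs
      = (- 2 \<cdot>\<^sub>\<Lambda> (omega g \<xi> i c x + eta g \<xi> (i + 1) c x \<and>\<^sub>\<Lambda> eta g \<xi> (i + 2) c x)) vs"
    unfolding scale_form_apply plus_fun_apply omega_def .
qed

lemma eta_differentiable: "(\<lambda>y. eta g \<xi> i c y vs) differentiable (at x)"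
proof -
  have "(\<lambda>y. g c y (\<xi> i c y) v) differentiable (at x)" for v
    using G_pairing_differentiable(1)[OF x sasaki.V_differentiable[OF x], of "\<lambda>_. v" i] by simp
  \<comment> \<open>The case rule merely separates empty, one-element and longer lists.\<close>
  then show ?thesis by (cases vs rule: remdups_adj.cases) (simp_all add: eta_eq)
qed

lemma ext_d_eta_connection:
  "ext_d (eta_connection g \<xi> a c) x = \<i> \<cdot>\<^sub>\<Lambda> (\<lambda>vs. complex_of_real (\<Sum>j\<in>UNIV. a $ j * ext_d (eta g \<xi> j c) x vs))"
proof
  fix vs
  have "directional (\<lambda>y. eta_connection g \<xi> a c y ws) x u
      = \<i> * complex_of_real (\<Sum>j\<in>UNIV. a $ j * directional (\<lambda>y. eta g \<xi> j c y ws) x u)" for ws u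
  proof -
    have "((\<lambda>y. \<i> * complex_of_real (\<Sum>j\<in>UNIV. a $ j * eta g \<xi> j c y ws)) has_derivative
      (\<lambda>u. \<i> * complex_of_real (\<Sum>j\<in>UNIV. a $ j * directional (\<lambda>y. eta g \<xi> j c y ws) x u))) (at x)"
      by (intro has_derivative_mult_right has_derivative_of_real has_derivative_sum
          has_derivative_directional eta_differentiable)
    from fun_cong[OF frechet_derivative_at[OF this], of u] show ?thesis
      unfolding eta_connection_def by simp
  qed
  moreover have "(\<Sum>j\<in>UNIV. a $ j * (\<Sum>k<n. s k * D j k)) = (\<Sum>k<n. s k * (\<Sum>j\<in>UNIV. a $ j * D j k))"
    for D :: "3 \<Rightarrow> nat \<Rightarrow> real" and s :: "nat \<Rightarrow> real" and n
    unfolding sum_distrib_left by (subst sum.swap) (simp add: mult.left_commute)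
  moreover have "(\<Sum>k<n. (-1) ^ k * (\<i> * complex_of_real (h k))) = \<i> * complex_of_real (\<Sum>k<n. (-1) ^ k * h k)"
    for h :: "nat \<Rightarrow> real" and n
    by (simp add: sum_distrib_left mult.left_commute)
  ultimately show "ext_d (eta_connection g \<xi> a c) x vs
      = (\<i> \<cdot>\<^sub>\<Lambda> (\<lambda>vs. complex_of_real (\<Sum>j\<in>UNIV. a $ j * ext_d (eta g \<xi> j c) x vs))) vs"
    by (simp only: ext_d_def scale_form_apply)
qed

lemma instanton_equation_iff:
  fixes a :: "real ^ 3" and t \<epsilon> :: real
  defines "F \<equiv> ext_d (eta_connection g \<xi> a c) x"
  defines "n \<equiv> (a $ 1)\<^sup>2 + (a $ 2)\<^sup>2 + (a $ 3)\<^sup>2"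
  shows "(\<forall>vs. (1/6) * (F \<and>\<^sub>\<Lambda> F \<and>\<^sub>\<Lambda> F) vs + (F \<and>\<^sub>\<Lambda> (\<lambda>ws. complex_of_real (psi t \<epsilon> g \<xi> c x ws))) vs = 0)
    \<longleftrightarrow> (4 * n + 2 * t\<^sup>2 * \<epsilon> - 1) * a $ 1 = 0 \<and> (4 * n + 2 * t\<^sup>2 * \<epsilon> - 1) * a $ 2 = 0
      \<and> (4 * n + 2 * t\<^sup>2 - 1) * a $ 3 = 0"
    (is "(\<forall>vs. ?eq vs) \<longleftrightarrow> ?R")
proof -
  obtain e where e: "adapted_frame e" using adapted_frame_exists ..
  define E where "E = (\<lambda>k. one_form (coframe e k))"
  define Fr where "Fr = - 2 \<cdot>\<^sub>\<Lambda> (self_dual E (a $ 1) (a $ 2) (a $ 3) + vertical E (a $ 1) (a $ 2) (a $ 3))"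
  define vol where "vol = wedge_list (map E [0, 1, 2, 3])"
  have om: "omega g \<xi> 1 c x = self_dual E 1 0 0" "omega g \<xi> 2 c x = self_dual E 0 1 0"
    "omega g \<xi> 3 c x = self_dual E 0 0 1"
    using e unfolding adapted_frame_def E_def by simp_all
  have et: "eta g \<xi> 1 c x = E 4" "eta g \<xi> 2 c x = E 5" "eta g \<xi> 3 c x = E 6"
    unfolding E_def by (rule eta_coframe)+
  have "(\<Sum>j\<in>UNIV. a $ j * ext_d (eta g \<xi> j c) x vs) = Fr vs" for vs
    unfolding sum_3 ext_d_eta_form add_3_simps om et Fr_def
    by (simp add: self_dual_def vertical_def algebra_simps)
  then have F: "F = \<i> \<cdot>\<^sub>\<Lambda> (\<lambda>vs. complex_of_real (Fr vs))"
    unfolding F_def ext_d_eta_connection by simp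
  have psi: "psi t \<epsilon> g \<xi> c x = vol + - (t\<^sup>2) \<cdot>\<^sub>\<Lambda>
      (\<epsilon> \<cdot>\<^sub>\<Lambda> ((E 5 \<and>\<^sub>\<Lambda> E 6) \<and>\<^sub>\<Lambda> self_dual E 1 0 0) + \<epsilon> \<cdot>\<^sub>\<Lambda> ((E 6 \<and>\<^sub>\<Lambda> E 4) \<and>\<^sub>\<Lambda> self_dual E 0 1 0)
        + (E 4 \<and>\<^sub>\<Lambda> E 5) \<and>\<^sub>\<Lambda> self_dual E 0 0 1)"
    by (rule ext) (simp add: psi_eq[OF e] standard_psi_g2_coordinates vol_def E_def)
  have cube: "Fr \<and>\<^sub>\<Lambda> Fr \<and>\<^sub>\<Lambda> Fr = (- 48 * n) \<cdot>\<^sub>\<Lambda> (vol \<and>\<^sub>\<Lambda> vertical E (a $ 1) (a $ 2) (a $ 3))"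
    unfolding Fr_def E_def vol_def n_def by (rule curvature_cube)
  have Fpsi: "Fr \<and>\<^sub>\<Lambda> psi t \<epsilon> g \<xi> c x = vol \<and>\<^sub>\<Lambda>
        vertical E ((4 * t\<^sup>2 * \<epsilon> - 2) * a $ 1) ((4 * t\<^sup>2 * \<epsilon> - 2) * a $ 2) ((4 * t\<^sup>2 - 2) * a $ 3)"
    unfolding psi unfolding Fr_def E_def vol_def by (rule curvature_wedge_psi)
  \<comment> \<open>The cube carries \<i>^3 = -\<i> and the other term \<i>, so after division by
    \<i> the cubic coefficient is -(-48 n) / 6 = 8 n.\<close>
  define lhs where "lhs = (8 * n) \<cdot>\<^sub>\<Lambda> (vol \<and>\<^sub>\<Lambda> vertical E (a $ 1) (a $ 2) (a $ 3)) + Fr \<and>\<^sub>\<Lambda> psi t \<epsilon> g \<xi> c x"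
  have "(1/6) * (F \<and>\<^sub>\<Lambda> F \<and>\<^sub>\<Lambda> F) vs + (F \<and>\<^sub>\<Lambda> (\<lambda>ws. complex_of_real (psi t \<epsilon> g \<xi> c x ws))) vs
      = \<i> * complex_of_real (lhs vs)" for vs
    unfolding F wedge_scale_left wedge_scale_right wedge_of_real cube lhs_def
    by (simp add: algebra_simps)
  then have "(\<forall>vs. ?eq vs) \<longleftrightarrow> lhs = 0" by (simp add: fun_eq_iff)
  also have "lhs = vol \<and>\<^sub>\<Lambda> vertical E ((8 * n + 4 * t\<^sup>2 * \<epsilon> - 2) * a $ 1) ((8 * n + 4 * t\<^sup>2 * \<epsilon> - 2) * a $ 2)
      ((8 * n + 4 * t\<^sup>2 - 2) * a $ 3)"
    unfolding lhs_def Fpsi vertical_def wedge_add_right wedge_scale_right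
    by (rule ext) (simp add: algebra_simps)
  also have "\<dots> = 0 \<longleftrightarrow> (8 * n + 4 * t\<^sup>2 * \<epsilon> - 2) * a $ 1 = 0 \<and> (8 * n + 4 * t\<^sup>2 * \<epsilon> - 2) * a $ 2 = 0
      \<and> (8 * n + 4 * t\<^sup>2 - 2) * a $ 3 = 0"
    unfolding vol_def E_def
    by (rule horizontal_volume_wedge_vertical_eq_0_iff[of "coframe e" "frame e"])
      (rule frame_dual[OF adapted_frame_horizontal[OF e]])
  also have "\<dots> \<longleftrightarrow> ?R"
  proof -
    have "(8 * n + 4 * t\<^sup>2 * \<epsilon> - 2) * y = 2 * ((4 * n + 2 * t\<^sup>2 * \<epsilon> - 1) * y)"
      "(8 * n + 4 * t\<^sup>2 - 2) * y = 2 * ((4 * n + 2 * t\<^sup>2 - 1) * y)" for y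
      by (simp_all add: algebra_simps)
    moreover have "2 * z = 0 \<longleftrightarrow> z = 0" for z :: real by simp
    ultimately show ?thesis by (simp only:)
  qed
  finally show ?thesis .
qed

end

section \<open>From the equation at a point to the sets of solutions\<close>

lemma three_sasakian_chart_point:
  assumes "three_sasakian X \<A> g \<xi>"
  obtains c x where "c \<in> \<A>" "x \<in> chart_image c"
proof -
  have "smooth_atlas X \<A>" using assms by (simp only: three_sasakian_def)
  then have "topspace X \<noteq> {}" and "(\<Union>c\<in>\<A>. fst c) = topspace X"
    by (simp_all only: smooth_atlas_def simp_thms)
  then have "(\<Union>c\<in>\<A>. fst c) \<noteq> {}" by metis
  then obtain c p where "c \<in> \<A>" "p \<in> fst c" by blast
  then show thesis using that[of c "snd c p"] by (simp add: chart_image_def)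
qed

lemma g2_structure_phi_psi:
  assumes "three_sasakian X \<A> g \<xi>" "t \<noteq> 0" "\<epsilon> \<in> {1, -1}"
  shows "g2_structure \<A> (phi t \<epsilon> g \<xi>) (canonical_metric t g \<xi>) (psi t \<epsilon> g \<xi>)"
  unfolding g2_structure_def
  by (intro ballI three_sasakian_point.g2_identification[OF three_sasakian_point.intro[OF assms(1)] assms(2,3)])

lemma norm_vec3: "(norm a)\<^sup>2 = (a $ 1)\<^sup>2 + (a $ 2)\<^sup>2 + (a $ 3)\<^sup>2" for a :: "real ^ 3"
  unfolding power2_norm_eq_inner inner_vec_def sum_3 by (simp add: power2_eq_square)

lemma vec3_eq_0_iff: "(a :: real ^ 3) = 0 \<longleftrightarrow> a $ 1 = 0 \<and> a $ 2 = 0 \<and> a $ 3 = 0"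
  by (simp add: vec_eq_iff forall_3)

lemma nontrivial_instantons_eq:
  assumes "three_sasakian X \<A> g \<xi>" "t \<noteq> 0" "\<epsilon> \<in> {1, -1}"
  shows "nontrivial_instantons \<A> g \<xi> t \<epsilon> = {a. a \<noteq> 0 \<and>
    (4 * (norm a)\<^sup>2 + 2 * t\<^sup>2 * \<epsilon> - 1) * a $ 1 = 0 \<and> (4 * (norm a)\<^sup>2 + 2 * t\<^sup>2 * \<epsilon> - 1) * a $ 2 = 0 \<and>
    (4 * (norm a)\<^sup>2 + 2 * t\<^sup>2 - 1) * a $ 3 = 0}"
proof -
  have point: "three_sasakian_point X \<A> g \<xi> c x" if "c \<in> \<A>" "x \<in> chart_image c" for c x
    using assms(1) that by (rule three_sasakian_point.intro)
  \<comment> \<open>The scalar equations do not mention the point; one existing point suffices to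
    strip the quantifiers over charts and points.\<close>
  obtain c0 x0 where c0: "c0 \<in> \<A>" "x0 \<in> chart_image c0"
    using three_sasakian_chart_point[OF assms(1)] .
  have "deformed_g2_instanton \<A> (phi t \<epsilon> g \<xi>) (psi t \<epsilon> g \<xi>) (eta_connection g \<xi> a) \<longleftrightarrow>
    (4 * (norm a)\<^sup>2 + 2 * t\<^sup>2 * \<epsilon> - 1) * a $ 1 = 0 \<and> (4 * (norm a)\<^sup>2 + 2 * t\<^sup>2 * \<epsilon> - 1) * a $ 2 = 0 \<and>
    (4 * (norm a)\<^sup>2 + 2 * t\<^sup>2 - 1) * a $ 3 = 0" (is "_ \<longleftrightarrow> ?R") for a
  proof -
    have "\<exists>h. g2_structure \<A> (phi t \<epsilon> g \<xi>) h (psi t \<epsilon> g \<xi>)"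
      by (intro exI) (rule g2_structure_phi_psi[OF assms])
    moreover have "Re (eta_connection g \<xi> a c x vs) = 0" for c x vs
      by (simp add: eta_connection_def)
    ultimately have "deformed_g2_instanton \<A> (phi t \<epsilon> g \<xi>) (psi t \<epsilon> g \<xi>) (eta_connection g \<xi> a)
        \<longleftrightarrow> (\<forall>c\<in>\<A>. \<forall>x\<in>chart_image c. ?R)"
      unfolding deformed_g2_instanton_def Let_def norm_vec3
      by (simp only: three_sasakian_point.instanton_equation_iff[OF point] cong: ball_cong) simp
    then show ?thesis using c0 by blast
  qed
  then show ?thesis unfolding nontrivial_instantons_def by blast
qed

text \<open>Here \<open>r\<close> is the squared radius; the centre is the origin and the normal is
  \<open>axis 3 1\<close>.\<close>

lemma is_circle_horizontal:
  assumes "r > 0"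
  shows "is_circle {a :: real ^ 3. a $ 3 = 0 \<and> (norm a)\<^sup>2 = r}"
proof -
  have inner: "axis 3 1 \<bullet> (a - 0) = a $ 3" for a :: "real ^ 3"
    by (simp add: inner_axis')
  have "a \<in> sphere 0 (sqrt r) \<longleftrightarrow> (norm a)\<^sup>2 = r" for a :: "real ^ 3"
    using assms by (auto simp: real_sqrt_unique)
  then have "{a :: real ^ 3. a $ 3 = 0 \<and> (norm a)\<^sup>2 = r} = {a \<in> sphere 0 (sqrt r). axis 3 1 \<bullet> (a - 0) = 0}"
    unfolding inner by blast
  moreover have "(axis 3 1 :: real ^ 3) \<noteq> 0" by (simp add: axis_eq_0_iff)
  moreover have "sqrt r > 0" using assms by simp
  ultimately show ?thesis
    unfolding is_circle_def by blast
qed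

lemma isolated_in_openI:
  assumes "p \<in> S" "open U" "p \<in> U" "\<And>a. a \<in> S \<Longrightarrow> a \<in> U \<Longrightarrow> a = p"
  shows "p isolated_in S"
  unfolding isolated_in_def using assms by blast

theorem corollary4p7:
  fixes X :: "'p topology" and \<A> :: "'p chart set"
    and g :: "'p bifield" and \<xi> :: "3 \<Rightarrow> 'p vfield"
  assumes "three_sasakian X \<A> g \<xi>"
  shows
    "(\<forall>c\<in>\<A>. \<forall>x\<in>chart_image c. \<forall>u v. g c x u v = canonical_metric 1 g \<xi> c x u v) \<and>
     (\<forall>\<epsilon>\<in>{1, -1}.
        g2_structure \<A> (phi 1 \<epsilon> g \<xi>) (canonical_metric 1 g \<xi>) (psi 1 \<epsilon> g \<xi>) \<and>
        g2_structure \<A> (phi (1 / sqrt 5) \<epsilon> g \<xi>) (canonical_metric (1 / sqrt 5) g \<xi>)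
          (psi (1 / sqrt 5) \<epsilon> g \<xi>)) \<and>
     is_circle (nontrivial_instantons \<A> g \<xi> 1 (-1)) \<and>
     nontrivial_instantons \<A> g \<xi> 1 1 = {} \<and>
     (\<exists>C p q. is_circle C \<and> p \<noteq> q \<and> p \<notin> C \<and> q \<notin> C \<and>
        nontrivial_instantons \<A> g \<xi> (1 / sqrt 5) (-1) = C \<union> {p, q} \<and>
        p isolated_in nontrivial_instantons \<A> g \<xi> (1 / sqrt 5) (-1) \<and>
        q isolated_in nontrivial_instantons \<A> g \<xi> (1 / sqrt 5) (-1)) \<and>
     is_two_sphere (nontrivial_instantons \<A> g \<xi> (1 / sqrt 5) 1)"
proof (intro conjI)
  note inst = nontrivial_instantons_eq[OF assms]
  have t: "(1 / sqrt 5)\<^sup>2 = (1 / 5 :: real)" "1 / sqrt 5 \<noteq> (0 :: real)"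
    by (simp_all add: power_divide)
  have coeff: "4 * N + 2 * (1 / 5) * - 1 - 1 = 4 * N - 7 / 5" "4 * N + 2 * (1 / 5) * 1 - 1 = 4 * N - 3 / 5"
    "4 * N + 2 * (1 / 5) - 1 = 4 * N - 3 / 5" for N :: real
    by simp_all
  show "\<forall>c\<in>\<A>. \<forall>x\<in>chart_image c. \<forall>u v. g c x u v = canonical_metric 1 g \<xi> c x u v"
    using three_sasakian_point.canonical_metric_1[OF three_sasakian_point.intro[OF assms]] by simp
  show "\<forall>\<epsilon>\<in>{1, -1}.
        g2_structure \<A> (phi 1 \<epsilon> g \<xi>) (canonical_metric 1 g \<xi>) (psi 1 \<epsilon> g \<xi>) \<and>
        g2_structure \<A> (phi (1 / sqrt 5) \<epsilon> g \<xi>) (canonical_metric (1 / sqrt 5) g \<xi>)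
          (psi (1 / sqrt 5) \<epsilon> g \<xi>)"
    using g2_structure_phi_psi[OF assms] t(2) by simp
  \<comment> \<open>The factors are 4 |a|^2 - 3 for the first two components and the positive 4
    |a|^2 + 1 for the third, which forces a_3 = 0.\<close>
  have "nontrivial_instantons \<A> g \<xi> 1 (-1) = {a. a $ 3 = 0 \<and> (norm a)\<^sup>2 = 3 / 4}"
  proof (rule set_eqI)
    fix a :: "real ^ 3"
    have "4 * (norm a)\<^sup>2 + 1 > 0" using zero_le_power2[of "norm a"] by linarith
    moreover have "a = 0 \<longleftrightarrow> a $ 1 = 0 \<and> a $ 2 = 0 \<and> a $ 3 = 0" by (rule vec3_eq_0_iff)
    moreover have "(norm a)\<^sup>2 = 3 / 4 \<Longrightarrow> a \<noteq> 0" by auto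
    ultimately show "a \<in> nontrivial_instantons \<A> g \<xi> 1 (-1) \<longleftrightarrow> a \<in> {a. a $ 3 = 0 \<and> (norm a)\<^sup>2 = 3 / 4}"
      by (auto simp: inst)
  qed
  then show "is_circle (nontrivial_instantons \<A> g \<xi> 1 (-1))"
    using is_circle_horizontal[of "3 / 4"] by simp
  show "nontrivial_instantons \<A> g \<xi> 1 1 = {}"
  proof -
    have "a = 0" if "(4 * (norm a)\<^sup>2 + 1) * a $ 1 = 0" "(4 * (norm a)\<^sup>2 + 1) * a $ 2 = 0"
      "(4 * (norm a)\<^sup>2 + 1) * a $ 3 = 0" for a :: "real ^ 3"
    proof -
      have "4 * (norm a)\<^sup>2 + 1 > 0" using zero_le_power2[of "norm a"] by linarith
      then show ?thesis using that unfolding vec3_eq_0_iff by simp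
    qed
    then show ?thesis by (auto simp: inst)
  qed
  show "\<exists>C p q. is_circle C \<and> p \<noteq> q \<and> p \<notin> C \<and> q \<notin> C \<and>
        nontrivial_instantons \<A> g \<xi> (1 / sqrt 5) (-1) = C \<union> {p, q} \<and>
        p isolated_in nontrivial_instantons \<A> g \<xi> (1 / sqrt 5) (-1) \<and>
        q isolated_in nontrivial_instantons \<A> g \<xi> (1 / sqrt 5) (-1)"
  proof -
    \<comment> \<open>The factors 4 |a|^2 - 7/5 and 4 |a|^2 - 3/5 vanish at different radii. If a_3
      is nonzero, then |a|^2 = 3/20, the first factor is nonzero and only two points on the third
      axis remain; otherwise |a|^2 = 7/20.\<close>
    let ?C = "{a :: real ^ 3. a $ 3 = 0 \<and> (norm a)\<^sup>2 = 7 / 20}"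
    let ?I = "nontrivial_instantons \<A> g \<xi> (1 / sqrt 5) (-1)"
    define s :: real where "s = sqrt (3 / 20)"
    define p q :: "real ^ 3" where "p = axis 3 s" and "q = axis 3 (- s)"
    have s: "s > 0" "s\<^sup>2 = 3 / 20" by (simp_all add: s_def)
    have nth: "p $ 1 = 0" "p $ 2 = 0" "p $ 3 = s" "q $ 1 = 0" "q $ 2 = 0" "q $ 3 = - s"
      by (simp_all add: p_def q_def axis_def)
    have eq: "?I = ?C \<union> {p, q}"
    proof (rule set_eqI)
      fix a :: "real ^ 3"
      have I: "a \<in> ?I \<longleftrightarrow> a \<noteq> 0 \<and> (4 * (norm a)\<^sup>2 - 7 / 5) * a $ 1 = 0 \<and> (4 * (norm a)\<^sup>2 - 7 / 5) * a $ 2 = 0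
          \<and> (4 * (norm a)\<^sup>2 - 3 / 5) * a $ 3 = 0"
        unfolding inst[OF t(2) insertI2[OF singletonI]] t(1) mem_Collect_eq by (simp only: coeff)
      have pq: "a = p \<or> a = q \<longleftrightarrow> a $ 1 = 0 \<and> a $ 2 = 0 \<and> (a $ 3)\<^sup>2 = s\<^sup>2"
        using nth by (auto simp: vec_eq_iff forall_3 power2_eq_iff)
      show "a \<in> ?I \<longleftrightarrow> a \<in> ?C \<union> {p, q}"
      proof (cases "a $ 3 = 0")
        case True
        then have "\<not> (a = p \<or> a = q)" using pq s by auto
        moreover have "(norm a)\<^sup>2 = 7 / 20 \<Longrightarrow> a \<noteq> 0" by auto
        ultimately show ?thesis using True I vec3_eq_0_iff[of a] by auto
      next
        case False
        then show ?thesis using I pq vec3_eq_0_iff[of a] s norm_vec3[of a] by auto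
      qed
    qed
    have "is_circle ?C" by (rule is_circle_horizontal) simp
    moreover have "p \<noteq> q" "p \<notin> ?C" "q \<notin> ?C" using nth s by auto
    \<comment> \<open>The circle lies in the plane a_3 = 0, so each open half-space beside it
      contains exactly one of the two points.\<close>
    moreover have "p isolated_in ?I"
      by (rule isolated_in_openI[where U = "{a. a $ 3 > 0}"])
        (use eq nth s in \<open>auto simp: open_halfspace_component_gt_cart\<close>)
    moreover have "q isolated_in ?I"
      by (rule isolated_in_openI[where U = "{a. a $ 3 < 0}"])
        (use eq nth s in \<open>auto simp: open_halfspace_component_lt_cart\<close>)
    ultimately show ?thesis using eq by blast
  qed
  \<comment> \<open>For \<epsilon> = 1 the three factors coincide, so a nonzero vector is
    constrained by its norm alone.\<close>
  have "nontrivial_instantons \<A> g \<xi> (1 / sqrt 5) 1 = sphere 0 (sqrt (3 / 20))"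
  proof (rule set_eqI)
    fix a :: "real ^ 3"
    have I: "a \<in> nontrivial_instantons \<A> g \<xi> (1 / sqrt 5) 1 \<longleftrightarrow> a \<noteq> 0 \<and>
        (4 * (norm a)\<^sup>2 - 3 / 5) * a $ 1 = 0 \<and> (4 * (norm a)\<^sup>2 - 3 / 5) * a $ 2 = 0
        \<and> (4 * (norm a)\<^sup>2 - 3 / 5) * a $ 3 = 0"
      unfolding inst[OF t(2) insertI1] t(1) mem_Collect_eq by (simp only: coeff)
    have "a \<in> sphere 0 (sqrt (3 / 20)) \<longleftrightarrow> (norm a)\<^sup>2 = 3 / 20"
      by (auto simp: real_sqrt_unique)
    moreover have "(norm a)\<^sup>2 = 3 / 20 \<Longrightarrow> a \<noteq> 0" by auto
    ultimately show "a \<in> nontrivial_instantons \<A> g \<xi> (1 / sqrt 5) 1 \<longleftrightarrow> a \<in> sphere 0 (sqrt (3 / 20))"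
      using I vec3_eq_0_iff[of a] by auto
  qed
  then show "is_two_sphere (nontrivial_instantons \<A> g \<xi> (1 / sqrt 5) 1)"
    unfolding is_two_sphere_def by (intro exI[of _ 0] exI[of _ "sqrt (3 / 20)"]) simp
qed

end
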